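(* Let $G_c=([n],E_c)$ be a connected undirected graph on the vertex set $[n]=\{1,\dots,n\}$, $n\ge 2$, without self-loops, with symmetric adjacency matrix $A_c=[a_{uv}]$, degrees $d_v=\sum_{u}a_{uv}\ge 1$ and degree matrix $D_c=\mathrm{diag}(d_v)$. For each $v\in[n]$ let $p_v\in(0,1)$ and $q_v=1-p_v$. For each time $k\ge 1$, let $\tilde A_k=[\tilde a^{(k)}_{uv}]$ be a random matrix with $\tilde a^{(k)}_{uv}=a_{uv}$ with probability $p_v$ and $\tilde a^{(k)}_{uv}=0$ with probability $1-p_v$, where all entries are independent of each other and the matrices $\tilde A_1,\tilde A_2,\dots$ are i.i.d. Let $\tilde D_k=\mathrm{diag}(\tilde d^{(k)}_v)$ with $\tilde d^{(k)}_v=\sum_u \tilde a^{(k)}_{uv}$, and $W_k=(\tilde D_k+I)^{-1}(\tilde A_k+I)^T$. Consider the dynamics $\mathbf{x}(k)=W_k\mathbf{x}(k-1)$, $k\ge1$, with deterministic initial condition $\mathbf{x}(0)\in\mathbb{R}^n$, and let $x^*$ be the (almost sure) asymptotic consensus value. For each $i$ set $$M_i^{(1)}=\frac{1-q_i^{d_i+1}}{p_i(d_i+1)},\qquad S_i=2\big(1-M_i^{(1)}\big)\Big[M_i^{(1)}+\frac{1}{d_i}\big(M_i^{(1)}-1\big)\Big].$$ Let $\lambda_1,\dots,\lambda_n$ be the eigenvalues (with multiplicity) of $\mathbb{E}W_k=\Sigma+(I-\Sigma)D_c^{-1}A_c^T$, where $\Sigma=\mathrm{diag}(M_i^{(1)})$,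 ordered so that $|1-\lambda_i|\le|1-\lambda_j|$ whenever $i\le j$. Then $$\mathrm{var}(x^* )\le \big\|\mathbf{x}(0)\otimes\mathbf{x}(0)\big\|_1\Big(\max_{1\le i\le n}S_i\Big)\left(\frac{2(n^2-1)}{\prod_{(i,j)\neq(1,1)}(1-\lambda_i\lambda_j)}\right),$$ where the product runs over all pairs $(i,j)\in[n]\times[n]$ with $(i,j)\neq(1,1)$.
   Context: The asymptotic consensus value $x^*$ is the random real number such that $x_i(k)\to x^*$ for all $i$ as $k\to\infty$ (this holds almost surely under the stated assumptions). $\otimes$ denotes the Kronecker product, so $\|\mathbf{x}(0)\otimes\mathbf{x}(0)\|_1=\sum_{1\le i,j\le n}|x_i(0)x_j(0)|$. $M_i^{(1)}$ equals $\mathbb{E}[1/(\tilde d^{(k)}_i+1)]$. *)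

theory Defs
  imports "HOL-Probability.Probability" "Jordan_Normal_Form.Char_Poly"
begin

text \<open>Vertices are 0..<n (instead of 1..n). Adjacency matrix a :: nat => nat => real.\<close>

definition adj_graph :: "nat \<Rightarrow> (nat \<Rightarrow> nat \<Rightarrow> real) \<Rightarrow> bool" where
  "adj_graph n a \<longleftrightarrow>
     (\<forall>u<n. \<forall>v<n. a u v = 0 \<or> a u v = 1) \<and>
     (\<forall>u<n. \<forall>v<n. a u v = a v u) \<and>
     (\<forall>v<n. a v v = 0)"

definition graph_connected :: "nat \<Rightarrow> (nat \<Rightarrow> nat \<Rightarrow> real) \<Rightarrow> bool" where
  "graph_connected n a \<longleftrightarrow>
     (\<forall>u<n. \<forall>v<n. (\<lambda>x y. x < n \<and> y < n \<and> a x y \<noteq> 0)\<^sup>*\<^sup>* u v)"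

definition deg :: "nat \<Rightarrow> (nat \<Rightarrow> nat \<Rightarrow> real) \<Rightarrow> nat \<Rightarrow> real" where
  "deg n a v = (\<Sum>u<n. a u v)"

text \<open>Random entry: a~(k)_{uv} = a_{uv} if the Bernoulli(p_v) coin B k u v is true, else 0.\<close>
definition atil :: "(nat \<Rightarrow> nat \<Rightarrow> real) \<Rightarrow> (nat \<Rightarrow> nat \<Rightarrow> nat \<Rightarrow> 'w \<Rightarrow> bool)
    \<Rightarrow> nat \<Rightarrow> nat \<Rightarrow> nat \<Rightarrow> 'w \<Rightarrow> real" where
  "atil a B k u v \<omega> = (if B k u v \<omega> then a u v else 0)"

text \<open>x(k) = W_k x(k-1), W_k = (D~_k + I)^{-1} (A~_k + I)^T, i.e.
  x_i(k) = (x_i(k-1) + sum_j a~(k)_{ji} x_j(k-1)) / (d~(k)_i + 1).\<close>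
primrec xdyn :: "nat \<Rightarrow> (nat \<Rightarrow> nat \<Rightarrow> real) \<Rightarrow> (nat \<Rightarrow> nat \<Rightarrow> nat \<Rightarrow> 'w \<Rightarrow> bool)
    \<Rightarrow> (nat \<Rightarrow> real) \<Rightarrow> nat \<Rightarrow> 'w \<Rightarrow> nat \<Rightarrow> real" where
  "xdyn n a B x0 0 \<omega> = x0"
| "xdyn n a B x0 (Suc k) \<omega> = (\<lambda>i.
     (xdyn n a B x0 k \<omega> i + (\<Sum>j<n. atil a B (Suc k) j i \<omega> * xdyn n a B x0 k \<omega> j))
     / ((\<Sum>u<n. atil a B (Suc k) u i \<omega>) + 1))"

text \<open>Asymptotic consensus value x^* (limit of any component; we take component 0).\<close>
definition xstar :: "nat \<Rightarrow> (nat \<Rightarrow> nat \<Rightarrow> real) \<Rightarrow> (nat \<Rightarrow> nat \<Rightarrow> nat \<Rightarrow> 'w \<Rightarrow> bool)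
    \<Rightarrow> (nat \<Rightarrow> real) \<Rightarrow> 'w \<Rightarrow> real" where
  "xstar n a B x0 \<omega> = lim (\<lambda>k. xdyn n a B x0 k \<omega> 0)"

definition M1 :: "nat \<Rightarrow> (nat \<Rightarrow> nat \<Rightarrow> real) \<Rightarrow> (nat \<Rightarrow> real) \<Rightarrow> nat \<Rightarrow> real" where
  "M1 n a p i = (1 - (1 - p i) ^ (nat \<lfloor>deg n a i\<rfloor> + 1)) / (p i * (deg n a i + 1))"

definition Sfac :: "nat \<Rightarrow> (nat \<Rightarrow> nat \<Rightarrow> real) \<Rightarrow> (nat \<Rightarrow> real) \<Rightarrow> nat \<Rightarrow> real" where
  "Sfac n a p i = 2 * (1 - M1 n a p i) * (M1 n a p i + (1 / deg n a i) * (M1 n a p i - 1))"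

text \<open>E W_k = Sigma + (I - Sigma) D_c^{-1} A_c^T, Sigma = diag(M1_i).\<close>
definition EW :: "nat \<Rightarrow> (nat \<Rightarrow> nat \<Rightarrow> real) \<Rightarrow> (nat \<Rightarrow> real) \<Rightarrow> real mat" where
  "EW n a p = mat n n (\<lambda>(i,j). (if i = j then M1 n a p i else 0)
       + (1 - M1 n a p i) * a j i / deg n a i)"

end

theory Submission
  imports Defs
begin

text \<open>
  The stochastic matrix \<open>P = EW\<close> is reversible: with \<open>Z\<close> the sum of all \<open>d\<^sub>i / (1 - M\<^sub>i)\<close>, the weights
  \<open>w\<^sub>i = d\<^sub>i / (1 - M\<^sub>i) / Z\<close> satisfy \<open>w\<^sub>i P\<^sub>i\<^sub>j = a\<^sub>i\<^sub>j / Z\<close> for \<open>i \<noteq> j\<close>. Hence \<open>y(t) = \<Sum> w\<^sub>i x\<^sub>i(t)\<close> is a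
  bounded martingale converging to \<open>x*\<close>. By Cauchy-Schwarz, and since the variances of row \<open>i\<close> of \<open>W\<^sub>k\<close> sum to
  \<open>S\<^sub>i / 2\<close>, each step adds at most \<open>(max w)\<^sup>2 (max S) / 2 \<cdot> G(t)\<close> to its variance, where \<open>G(t)\<close> is the sum of
  \<open>E (x\<^sub>i(t) - x\<^sub>j(t))\<^sup>2\<close> over directed edges. The energy \<open>E \<Sum> w\<^sub>i (x\<^sub>i(t) - c)\<^sup>2\<close> drops by at least
  \<open>G(t) / (n Z)\<close> in each step because the diagonal entries of \<open>W\<^sub>k\<close> are at least \<open>1/n\<close>. Choosing \<open>k\<close> with \<open>w\<^sub>k\<close>
  maximal and \<open>c = x\<^sub>k(0)\<close>, the sum of all \<open>G(t)\<close> is at most \<open>n Z (1 - w\<^sub>k)\<close> times the norm of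
  \<open>x(0) \<otimes> x(0)\<close>, and \<open>w\<^sub>k Z = d\<^sub>k / (1 - M\<^sub>k) \<le> (n - 1) / (1 - M\<^sub>k)\<close>.

  It remains to compare \<open>(1 - w\<^sub>k) / (1 - M\<^sub>k)\<close> with the eigenvalue product. The Rayleigh quotient of the indicator
  of \<open>k\<close> gives \<open>(1 - \<lambda>\<^sub>2) (1 - w\<^sub>k) \<le> 1 - M\<^sub>k\<close>. As the trace of \<open>P\<close> is at least \<open>1\<close>, the inequality
  \<open>1 - t \<le> exp (-t)\<close> bounds the product of the factors other than \<open>1 - \<lambda>\<^sub>1 \<lambda>\<^sub>2\<close> by
  \<open>exp (1 + \<lambda>\<^sub>2 - trace\<^sup>2) \<le> e \<le> 4\<close>.
\<close>

section \<open>Spectral theorem for real symmetric matrices\<close>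

lemma sum_mult_delta:
  fixes g :: "nat \<Rightarrow> real"
  assumes "j < n"
  shows "(\<Sum>k<n. g k * (if k = j then 1 else 0)) = g j"
    and "(\<Sum>k<n. g k * (if j = k then 1 else 0)) = g j"
  using assms by (simp_all add: if_distrib[of "\<lambda>x. _ * x"] cong: if_cong)

text \<open>The reflection in the hyperplane orthogonal to \<open>u\<close>. If \<open>u\<close>
  vanishes on \<open>{..<n}\<close>, then division by zero turns the factor into 0 and the matrix is
  the identity, which is still a symmetric involution.\<close>

definition householder :: "nat \<Rightarrow> (nat \<Rightarrow> real) \<Rightarrow> real mat" where
  "householder n u = mat n n (\<lambda>(i,j). (if i = j then 1 else 0) - 2 / (\<Sum>k<n. (u k)^2) * (u i * u j))"

lemma householder_carrier [simp]: "householder n u \<in> carrier_mat n n"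
  by (simp add: householder_def)

lemma householder_symmetric: "i < n \<Longrightarrow> j < n \<Longrightarrow> householder n u $$ (i,j) = householder n u $$ (j,i)"
  by (auto simp: householder_def)

lemma householder_involution: "householder n u * householder n u = 1\<^sub>m n"
proof (intro eq_matI)
  fix i j assume "i < dim_row (1\<^sub>m n :: real mat)" "j < dim_col (1\<^sub>m n :: real mat)"
  then have i: "i < n" and j: "j < n" by auto
  define s where "s = (\<Sum>k<n. (u k)^2)"
  let ?d = "\<lambda>i j::nat. if i = j then 1 else 0 :: real"
  \<comment> \<open>This also holds for \<open>s = 0\<close>, where \<open>2/s\<close> is 0, so a
    zero vector needs no separate case.\<close>
  have cs: "(2/s)^2 * s = 2 * (2/s)" by (simp add: power2_eq_square)
  have "(householder n u * householder n u) $$ (i,j)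
      = (\<Sum>k<n. (?d i k - 2/s * (u i * u k)) * (?d k j - 2/s * (u k * u j)))"
    using i j by (simp add: householder_def scalar_prod_def s_def atLeast0LessThan)
  also have "\<dots> = (\<Sum>k<n. (if k = i then ?d k j else 0) - (if k = i then 2/s * (u k * u j) else 0)
        - (if k = j then 2/s * (u i * u k) else 0) + (2/s)^2 * (u i * u j) * (u k)^2)"
    by (intro sum.cong) (auto simp: algebra_simps power2_eq_square)
  also have "\<dots> = ?d i j - 2/s * (u i * u j) - 2/s * (u i * u j) + ((2/s)^2 * s) * (u i * u j)"
    using i j by (simp add: sum.distrib sum_subtractf sum_distrib_left[symmetric] s_def)
  also have "\<dots> = ?d i j" unfolding cs by simp
  finally show "(householder n u * householder n u) $$ (i,j) = 1\<^sub>m n $$ (i,j)"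
    using i j by simp
qed (auto simp: householder_def)

text \<open>Reflecting in the hyperplane orthogonal to \<open>v - e0\<close> exchanges the unit
  vectors \<open>v\<close> and \<open>e0\<close>. The squared length of \<open>v - e0\<close> is
  \<open>2 - 2 * v 0\<close>, and it vanishes only if \<open>v = e0\<close>, where the identity does
  the job.\<close>

lemma householder_col0:
  assumes norm: "(\<Sum>k<n. (v k)^2) = 1" and i: "i < n"
  shows "householder n (\<lambda>k. v k - (if k = 0 then 1 else 0)) $$ (i,0) = v i"
proof -
  define u where "u = (\<lambda>k. v k - (if k = 0 then 1 else 0))"
  define s where "s = (\<Sum>k<n. (u k)^2)"
  have n: "0 < n" using i by simp
  have "s = (\<Sum>k<n. (v k)^2 - (if k = 0 then 2 * v k - 1 else 0))"
    unfolding s_def by (intro sum.cong) (auto simp: u_def power2_eq_square algebra_simps)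
  then have s: "s = 2 - 2 * v 0"
    using n norm by (simp add: sum_subtractf)
  have "householder n u $$ (i,0) = v i"
  proof (cases "s = 0")
    case True
    then have "\<forall>k<n. u k = 0" unfolding s_def by (subst (asm) sum_nonneg_eq_0_iff) auto
    then have "u i = 0" using i by auto
    then show ?thesis using i n by (auto simp: householder_def u_def split: if_splits)
  next
    case False
    then have "2 / s * u 0 = -1" using n s by (simp add: u_def field_simps)
    then have "u i * (2 / s * u 0) = - u i" by simp
    then have "2 / s * (u i * u 0) = - u i" by (simp add: mult_ac)
    then show ?thesis using i n by (auto simp: householder_def s_def u_def)
  qed
  then show ?thesis by (simp add: u_def)
qed

lemma mult_mat_index:
  fixes A B :: "real mat"
  assumes "A \<in> carrier_mat n m" "B \<in> carrier_mat m l" "i < n" "j < l"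
  shows "(A * B) $$ (i,j) = (\<Sum>k<m. A $$ (i,k) * B $$ (k,j))"
  using assms by (simp add: scalar_prod_def atLeast0LessThan)

lemma unit_eigenvector:
  fixes A :: "real mat"
  assumes A: "A \<in> carrier_mat n n" and root: "poly (char_poly A) e = 0"
  obtains v where "(\<Sum>k<n. (v k)^2) = 1" "\<And>i. i < n \<Longrightarrow> (\<Sum>k<n. A $$ (i,k) * v k) = e * v i"
proof -
  from root have "eigenvalue A e" by (simp add: eigenvalue_root_char_poly[OF A])
  then obtain z where z: "z \<in> carrier_vec n" "z \<noteq> 0\<^sub>v n" "A *\<^sub>v z = e \<cdot>\<^sub>v z"
    using A unfolding eigenvalue_def eigenvector_def by auto
  define y where "y k = vec_index z k" for k
  have ev: "(\<Sum>k<n. A $$ (i,k) * y k) = e * y i" if "i < n" for i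
    using arg_cong[OF z(3), of "\<lambda>x. vec_index x i"] that A z(1)
    by (simp add: y_def scalar_prod_def atLeast0LessThan)
  define r where "r = (\<Sum>k<n. (y k)^2)"
  have "r \<noteq> 0"
  proof
    assume "r = 0"
    then have "\<forall>k<n. y k = 0" unfolding r_def by (subst (asm) sum_nonneg_eq_0_iff) auto
    then have "z = 0\<^sub>v n" using z(1) by (intro eq_vecI) (auto simp: y_def)
    then show False using z by simp
  qed
  then have r: "r > 0" unfolding r_def by (simp add: sum_nonneg order_less_le)
  show thesis
  proof
    show "(\<Sum>k<n. (y k / sqrt r)^2) = 1"
      using r by (simp add: power_divide sum_divide_distrib[symmetric] r_def[symmetric])
    show "(\<Sum>k<n. A $$ (i,k) * (y k / sqrt r)) = e * (y i / sqrt r)" if "i < n" for i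
      using ev[OF that] by (simp add: sum_divide_distrib[symmetric])
  qed
qed

text \<open>Deflation by induction on the list of roots. The head of the list supplies a real
  eigenvalue, a Householder reflection moves a unit eigenvector to the first coordinate, and
  symmetry makes the conjugated matrix block diagonal with a smaller symmetric block.\<close>

lemma symmetric_mat_diagonalization:
  fixes A :: "real mat"
  assumes "A \<in> carrier_mat n n"
    and "\<And>i j. i < n \<Longrightarrow> j < n \<Longrightarrow> A $$ (i,j) = A $$ (j,i)"
    and "char_poly A = (\<Prod>e\<leftarrow>es. [:- e, 1:])"
    and "length es = n"
  shows "\<exists>U. (\<forall>l<n. \<forall>m<n. (\<Sum>i<n. U i l * U i m) = (if l = m then 1 else 0)) \<and>
             (\<forall>i<n. \<forall>m<n. (\<Sum>j<n. A $$ (i,j) * U j m) = es ! m * U i m)"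
  using assms
proof (induction es arbitrary: n A)
  case Nil
  then show ?case by simp
next
  case (Cons e es)
  note A = Cons.prems(1) and sym = Cons.prems(2)
  obtain n' where n: "n = Suc n'" "length es = n'" using Cons.prems(4) by auto
  have "poly (char_poly A) e = 0" using Cons.prems(3) by simp
  then obtain v where norm: "(\<Sum>k<n. (v k)^2) = 1"
    and ev: "\<And>i. i < n \<Longrightarrow> (\<Sum>k<n. A $$ (i,k) * v k) = e * v i"
    using unit_eigenvector[OF A] by blast
  define H where "H = householder n (\<lambda>k. v k - (if k = 0 then 1 else 0))"
  have H: "H \<in> carrier_mat n n" by (simp add: H_def)
  have HH: "H * H = 1\<^sub>m n" unfolding H_def by (rule householder_involution)
  have Hsym: "H $$ (i,j) = H $$ (j,i)" if "i < n" "j < n" for i j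
    unfolding H_def using that by (rule householder_symmetric)
  have H0: "H $$ (i,0) = v i" if "i < n" for i
    unfolding H_def using norm that by (rule householder_col0)
  \<comment> \<open>As \<open>H\<close> is its own inverse, this is a similarity. Column 0 of
    \<open>H\<close> is the eigenvector \<open>v\<close>, so column 0 of \<open>A'\<close> is
    \<open>e\<close> times the first unit vector, and by symmetry the same holds for row 0.\<close>
  define A' where "A' = H * (A * H)"
  have A': "A' \<in> carrier_mat n n" using A H by (simp add: A'_def)
  have AH0: "(A * H) $$ (i,0) = e * H $$ (i,0)" if "i < n" for i
    using that n ev by (subst mult_mat_index[OF A H]) (auto simp: H0)
  have A'0: "A' $$ (i,0) = (if i = 0 then e else 0)" if "i < n" for i
  proof -
    have "A' $$ (i,0) = (\<Sum>k<n. H $$ (i,k) * (A * H) $$ (k,0))"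
      unfolding A'_def using that n A H by (intro mult_mat_index) auto
    also have "\<dots> = e * (\<Sum>k<n. H $$ (i,k) * H $$ (k,0))"
      by (simp add: AH0 sum_distrib_left mult.assoc mult.left_commute)
    also have "(\<Sum>k<n. H $$ (i,k) * H $$ (k,0)) = (H * H) $$ (i,0)"
      using that n by (intro mult_mat_index[OF H H, symmetric]) auto
    finally show ?thesis using that n by (simp add: HH)
  qed
  have A'sym: "A' $$ (i,j) = A' $$ (j,i)" if "i < n" "j < n" for i j
  proof -
    have expand: "A' $$ (i,j) = (\<Sum>k<n. \<Sum>l<n. H $$ (i,k) * A $$ (k,l) * H $$ (l,j))"
      if "i < n" "j < n" for i j
      unfolding A'_def using that A H
      by (subst mult_mat_index[of _ n n _ n])
        (auto intro!: sum.cong simp: mult_mat_index[OF A H] sum_distrib_left mult.assoc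
           simp del: index_mult_mat)
    have swap: "H $$ (i,k) * A $$ (k,l) * H $$ (l,j) = H $$ (j,l) * A $$ (l,k) * H $$ (k,i)"
      if "k < n" "l < n" for k l
      using Hsym[of i k] Hsym[of l j] sym[of k l] that \<open>i < n\<close> \<open>j < n\<close> by simp
    show ?thesis unfolding expand[OF that] expand[OF that(2,1)]
      by (subst sum.swap) (auto intro!: sum.cong simp: swap)
  qed
  define A3 where "A3 = mat n' n' (\<lambda>(i,j). A' $$ (Suc i, Suc j))"
  have A3: "A3 \<in> carrier_mat n' n'" by (simp add: A3_def)
  have A3sym: "A3 $$ (i,j) = A3 $$ (j,i)" if "i < n'" "j < n'" for i j
    using that A'sym by (simp add: A3_def n)
  have block: "A' = four_block_mat (mat 1 1 (\<lambda>_. e)) (0\<^sub>m 1 n') (0\<^sub>m n' 1) A3"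
  proof (rule eq_matI)
    fix i j
    assume "i < dim_row (four_block_mat (mat 1 1 (\<lambda>_. e)) (0\<^sub>m 1 n') (0\<^sub>m n' 1) A3)"
      "j < dim_col (four_block_mat (mat 1 1 (\<lambda>_. e)) (0\<^sub>m 1 n') (0\<^sub>m n' 1) A3)"
    then have "i < n" "j < n" by (auto simp: A3_def n)
    moreover have "A' $$ (0,j) = (if j = 0 then e else 0)"
      using A'sym[of 0 j] A'0[of j] \<open>j < n\<close> n by simp
    ultimately show "A' $$ (i,j) = four_block_mat (mat 1 1 (\<lambda>_. e)) (0\<^sub>m 1 n') (0\<^sub>m n' 1) A3 $$ (i,j)"
      using A'0[of i] by (auto simp: A3_def n)
  qed (use A' in \<open>auto simp: A3_def n\<close>)
  have "similar_mat_wit A' A H H"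
    using A H A' HH by (intro similar_mat_witI[of _ _ n]) (auto simp: A'_def)
  then have "char_poly A' = char_poly A"
    by (intro char_poly_similar) (auto simp: similar_mat_def)
  moreover have "char_poly A' = char_poly (mat 1 1 (\<lambda>_. e)) * char_poly A3"
    unfolding block by (rule char_poly_four_block_zeros_col) (auto simp: A3_def)
  moreover have "char_poly (mat 1 1 (\<lambda>_. e)) = [:- e, 1:]"
    by (simp add: char_poly_defs det_def sign_def)
  ultimately have "[:- e, 1:] * char_poly A3 = [:- e, 1:] * (\<Prod>e\<leftarrow>es. [:- e, 1:])"
    using Cons.prems(3) by simp
  \<comment> \<open>Cancelling the linear factor of \<open>e\<close> shows that the remaining roots
    belong to the smaller block, as the induction hypothesis requires.\<close>
  then have "char_poly A3 = (\<Prod>e\<leftarrow>es. [:- e, 1:])"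
    by (metis mult_cancel_left pCons_eq_0_iff zero_neq_one)
  from Cons.IH[OF A3 A3sym this n(2)] obtain V where
    V: "\<And>l m. l < n' \<Longrightarrow> m < n' \<Longrightarrow> (\<Sum>i<n'. V i l * V i m) = (if l = m then 1 else 0)"
       "\<And>i m. i < n' \<Longrightarrow> m < n' \<Longrightarrow> (\<Sum>j<n'. A3 $$ (i,j) * V j m) = es ! m * V i m"
    by blast
  \<comment> \<open>The basis of the smaller block is bordered with a corner entry 1 for the
    eigenvector split off. Applying \<open>H\<close> then carries it back to the original
    coordinates.\<close>
  define V' where "V' i m = (case (i, m) of (Suc i, Suc m) \<Rightarrow> V i m | (0, 0) \<Rightarrow> 1 | _ \<Rightarrow> 0)" for i m
  have [simp]: "V' 0 0 = 1" "V' (Suc i) 0 = 0" "V' 0 (Suc i) = 0" "V' (Suc i) (Suc m) = V i m" for i m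
    by (auto simp: V'_def)
  have orth: "(\<Sum>i<n. V' i l * V' i m) = (if l = m then 1 else 0)" if "l < n" "m < n" for l m
    using that V(1) unfolding n by (cases l; cases m) (simp_all add: sum.lessThan_Suc_shift del: sum.lessThan_Suc)
  have A'block: "A' $$ (0,0) = e" "\<And>k. k < n' \<Longrightarrow> A' $$ (0, Suc k) = 0" "\<And>k. k < n' \<Longrightarrow> A' $$ (Suc k, 0) = 0"
     "\<And>k l. k < n' \<Longrightarrow> l < n' \<Longrightarrow> A' $$ (Suc k, Suc l) = A3 $$ (k,l)"
    using A'0 A'sym[of 0] by (auto simp: n A3_def)
  have eig: "(\<Sum>j<n. A' $$ (i,j) * V' j m) = (e # es) ! m * V' i m" if "i < n" "m < n" for i m
    using that V(2) unfolding n
    by (cases i; cases m) (simp_all add: sum.lessThan_Suc_shift A'block del: sum.lessThan_Suc)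
  define U where "U i m = (\<Sum>k<n. H $$ (i,k) * V' k m)" for i m
  have HHij: "(\<Sum>k<n. H $$ (i,k) * H $$ (k,j)) = (if i = j then 1 else 0)" if "i < n" "j < n" for i j
    using mult_mat_index[OF H H that] that by (simp add: HH)
  have AH: "A * H = H * A'"
    using A H HH assoc_mult_mat[OF H H, of "A * H" n] by (simp add: A'_def)
  show ?case
  proof (intro exI conjI allI impI)
    fix l m assume lm: "l < n" "m < n"
    have "(\<Sum>i<n. U i l * U i m)
        = (\<Sum>i<n. \<Sum>k<n. \<Sum>k'<n. V' k l * V' k' m * (H $$ (k,i) * H $$ (i,k')))"
      unfolding U_def sum_product by (intro sum.cong) (auto simp: Hsym)
    also have "\<dots> = (\<Sum>k<n. \<Sum>k'<n. V' k l * V' k' m * (\<Sum>i<n. H $$ (k,i) * H $$ (i,k')))"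
      unfolding sum_distrib_left by (subst sum.swap, rule sum.cong[OF refl], rule sum.swap)
    also have "\<dots> = (\<Sum>k<n. \<Sum>k'<n. V' k l * V' k' m * (if k = k' then 1 else 0))"
      by (intro sum.cong refl) (simp add: HHij)
    also have "\<dots> = (\<Sum>k<n. V' k l * V' k m)"
      by (intro sum.cong refl sum_mult_delta) simp
    finally show "(\<Sum>i<n. U i l * U i m) = (if l = m then 1 else 0)"
      using orth[OF lm] by simp
  next
    fix i m assume im: "i < n" "m < n"
    have "(\<Sum>j<n. A $$ (i,j) * U j m) = (\<Sum>k<n. (\<Sum>j<n. A $$ (i,j) * H $$ (j,k)) * V' k m)"
      unfolding U_def sum_distrib_left sum_distrib_right
      by (subst sum.swap) (simp add: mult.assoc)
    also have "\<dots> = (\<Sum>k<n. (\<Sum>j<n. H $$ (i,j) * A' $$ (j,k)) * V' k m)"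
      using mult_mat_index[OF A H im(1)] mult_mat_index[OF H A' im(1)]
      by (intro sum.cong) (auto simp: AH simp del: index_mult_mat)
    also have "\<dots> = (\<Sum>j<n. H $$ (i,j) * (\<Sum>k<n. A' $$ (j,k) * V' k m))"
      unfolding sum_distrib_left sum_distrib_right
      by (subst sum.swap) (simp add: mult.assoc)
    also have "\<dots> = (e # es) ! m * U i m"
      by (simp add: eig im U_def sum_distrib_left mult.left_commute)
    finally show "(\<Sum>j<n. A $$ (i,j) * U j m) = (e # es) ! m * U i m" .
  qed
qed


text \<open>Orthonormal columns say that the transpose is a left inverse. For square matrices it is
  also a right inverse, so the rows are orthonormal as well.\<close>

lemma orthogonal_completeness:
  fixes U :: "nat \<Rightarrow> nat \<Rightarrow> real"
  assumes orth: "\<And>l m. l < n \<Longrightarrow> m < n \<Longrightarrow> (\<Sum>i<n. U i l * U i m) = (if l = m then 1 else 0)"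
    and ij: "i < n" "j < n"
  shows "(\<Sum>m<n. U i m * U j m) = (if i = j then 1 else 0)"
proof -
  define A where "A = mat n n (\<lambda>(i,m). U i m)"
  define B where "B = mat n n (\<lambda>(m,i). U i m)"
  have c: "A \<in> carrier_mat n n" "B \<in> carrier_mat n n" by (auto simp: A_def B_def)
  have "B * A = 1\<^sub>m n"
  proof (rule eq_matI)
    fix l m assume "l < dim_row (1\<^sub>m n :: real mat)" "m < dim_col (1\<^sub>m n :: real mat)"
    then have lm: "l < n" "m < n" by auto
    then have "(B * A) $$ (l,m) = (\<Sum>i<n. U i l * U i m)"
      by (subst mult_mat_index[OF c(2,1)]) (auto simp: A_def B_def)
    then show "(B * A) $$ (l,m) = 1\<^sub>m n $$ (l,m)" using orth lm by simp
  qed (use c in auto)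
  then have AB: "A * B = 1\<^sub>m n" using mat_mult_left_right_inverse c by blast
  have "(A * B) $$ (i,j) = (\<Sum>m<n. U i m * U j m)"
    using ij by (subst mult_mat_index[OF c]) (auto simp: A_def B_def)
  then show ?thesis using AB ij by simp
qed

section \<open>Reversible stochastic matrices\<close>

text \<open>Conjugating by the square root of \<open>w\<close> makes \<open>P\<close> symmetric without changing the spectrum.\<close>

lemma reversible_eigenbasis:
  fixes P :: "nat \<Rightarrow> nat \<Rightarrow> real" and w :: "nat \<Rightarrow> real"
  assumes w: "\<And>i. i < n \<Longrightarrow> 0 < w i"
    and rev: "\<And>i j. i < n \<Longrightarrow> j < n \<Longrightarrow> w i * P i j = w j * P j i"
    and cp: "char_poly (mat n n (\<lambda>(i,j). P i j)) = (\<Prod>e\<leftarrow>ls. [:- e, 1:])"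
    and len: "length ls = n"
  obtains f where
    "\<And>l m. l < n \<Longrightarrow> m < n \<Longrightarrow> (\<Sum>i<n. w i * (f i l * f i m)) = (if l = m then 1 else 0)"
    "\<And>i j. i < n \<Longrightarrow> j < n \<Longrightarrow> (\<Sum>m<n. f i m * f j m) * w j = (if i = j then 1 else 0)"
    "\<And>i m. i < n \<Longrightarrow> m < n \<Longrightarrow> (\<Sum>j<n. P i j * f j m) = ls ! m * f i m"
proof -
  define Pm where "Pm = mat n n (\<lambda>(i,j). P i j)"
  define C where "C = mat n n (\<lambda>(i,j). sqrt (w i) * P i j / sqrt (w j))"
  define S where "S = mat n n (\<lambda>(i,j). if i = j then sqrt (w i) else 0)"
  define T where "T = mat n n (\<lambda>(i,j). if i = j then 1 / sqrt (w i) else 0)"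
  have c: "Pm \<in> carrier_mat n n" "C \<in> carrier_mat n n" "S \<in> carrier_mat n n" "T \<in> carrier_mat n n"
    by (auto simp: Pm_def C_def S_def T_def)
  have ST: "S * T = 1\<^sub>m n"
  proof (rule eq_matI)
    fix i j assume "i < dim_row (1\<^sub>m n :: real mat)" "j < dim_col (1\<^sub>m n :: real mat)"
    then have ij: "i < n" "j < n" by auto
    then have "(S * T) $$ (i,j) = (\<Sum>k<n. (if k = i then sqrt (w i) * (if i = j then 1 / sqrt (w i) else 0) else 0))"
      unfolding mult_mat_index[OF c(3,4) ij] by (intro sum.cong) (auto simp: S_def T_def)
    then show "(S * T) $$ (i,j) = 1\<^sub>m n $$ (i,j)" using ij w[of i] by (cases "i = j") auto
  qed (use c in auto)
  then have TS: "T * S = 1\<^sub>m n" using mat_mult_left_right_inverse c by blast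
  have SP: "S * Pm = mat n n (\<lambda>(i,j). sqrt (w i) * P i j)"
  proof (rule eq_matI)
    fix i j assume "i < dim_row (mat n n (\<lambda>(i,j). sqrt (w i) * P i j))" "j < dim_col (mat n n (\<lambda>(i,j). sqrt (w i) * P i j))"
    then have ij: "i < n" "j < n" by auto
    then have "(S * Pm) $$ (i,j) = (\<Sum>k<n. (if k = i then sqrt (w i) * P i j else 0))"
      unfolding mult_mat_index[OF c(3,1) ij] by (intro sum.cong) (auto simp: S_def Pm_def)
    then show "(S * Pm) $$ (i,j) = mat n n (\<lambda>(i,j). sqrt (w i) * P i j) $$ (i,j)" using ij by simp
  qed (use c in auto)
  have SPT: "S * Pm * T = C"
  proof (rule eq_matI)
    fix i j assume "i < dim_row C" "j < dim_col C"
    then have ij: "i < n" "j < n" by (auto simp: C_def)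
    then have "(S * Pm * T) $$ (i,j) = (\<Sum>k<n. (if k = j then sqrt (w i) * P i j * (1 / sqrt (w j)) else 0))"
      unfolding SP by (subst mult_mat_index[OF _ c(4) ij], simp, intro sum.cong) (auto simp: T_def)
    then show "(S * Pm * T) $$ (i,j) = C $$ (i,j)" using ij by (simp add: C_def)
  qed (use c in auto)
  have "similar_mat_wit C Pm S T"
    using c ST TS SPT by (intro similar_mat_witI[of _ _ n]) auto
  then have "char_poly C = char_poly Pm"
    by (intro char_poly_similar) (auto simp: similar_mat_def)
  then have cpC: "char_poly C = (\<Prod>e\<leftarrow>ls. [:- e, 1:])" using cp by (simp add: Pm_def)
  have sq: "sqrt (w i) * sqrt (w i) = w i" "sqrt (w i) > 0" if "i < n" for i
    using w[OF that] by auto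
  have sym: "C $$ (i,j) = C $$ (j,i)" if ij: "i < n" "j < n" for i j
  proof -
    have "sqrt (w i) * P i j * sqrt (w i) = sqrt (w j) * P j i * sqrt (w j)"
      using rev[OF ij] sq(1)[OF ij(1)] sq(1)[OF ij(2)] by (metis mult.assoc mult.commute)
    then show ?thesis using ij sq(2)[of i] sq(2)[of j] by (simp add: C_def field_simps)
  qed
  obtain U where
    U1: "\<And>l m. l < n \<Longrightarrow> m < n \<Longrightarrow> (\<Sum>i<n. U i l * U i m) = (if l = m then 1 else 0)" and
    U2: "\<And>i m. i < n \<Longrightarrow> m < n \<Longrightarrow> (\<Sum>j<n. C $$ (i,j) * U j m) = ls ! m * U i m"
    using symmetric_mat_diagonalization[OF c(2) sym cpC len] by blast
  \<comment> \<open>Undoing the conjugation turns the Euclidean orthonormality of \<open>U\<close>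
    into orthonormality for the inner product weighted by \<open>w\<close>.\<close>
  define f where "f i m = U i m / sqrt (w i)" for i m
  show thesis
  proof
    show "(\<Sum>i<n. w i * (f i l * f i m)) = (if l = m then 1 else 0)" if "l < n" "m < n" for l m
    proof -
      have "(\<Sum>i<n. w i * (f i l * f i m)) = (\<Sum>i<n. U i l * U i m)"
      proof (intro sum.cong refl)
        fix i assume "i \<in> {..<n}"
        then have "w i > 0" using w by simp
        then show "w i * (f i l * f i m) = U i l * U i m" by (simp add: f_def)
      qed
      then show ?thesis using U1 that by simp
    qed
    show "(\<Sum>m<n. f i m * f j m) * w j = (if i = j then 1 else 0)" if ij: "i < n" "j < n" for i j
    proof -
      have "(\<Sum>m<n. f i m * f j m) = (\<Sum>m<n. U i m * U j m) / (sqrt (w i) * sqrt (w j))"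
        by (simp add: f_def sum_divide_distrib)
      then show ?thesis using orthogonal_completeness[of n U i j] U1 ij sq[of i] w[OF ij(1)] by auto
    qed
    show "(\<Sum>j<n. P i j * f j m) = ls ! m * f i m" if im: "i < n" "m < n" for i m
    proof -
      have "sqrt (w i) * (\<Sum>j<n. P i j * f j m) = (\<Sum>j<n. C $$ (i,j) * U j m)"
        using im by (auto simp: sum_distrib_left C_def f_def intro!: sum.cong)
      then have "sqrt (w i) * (\<Sum>j<n. P i j * f j m) = ls ! m * U i m" using U2 im by simp
      then show ?thesis using sq[OF im(1)] by (simp add: f_def field_simps)
    qed
  qed
qed

lemma reversible_stationary:
  fixes P :: "nat \<Rightarrow> nat \<Rightarrow> real" and w :: "nat \<Rightarrow> real"
  assumes rev: "\<And>i j. i < n \<Longrightarrow> j < n \<Longrightarrow> w i * P i j = w j * P j i"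
    and rows: "\<And>i. i < n \<Longrightarrow> (\<Sum>j<n. P i j) = 1"
    and j: "j < n"
  shows "(\<Sum>i<n. w i * P i j) = w j"
proof -
  have "(\<Sum>i<n. w i * P i j) = (\<Sum>i<n. w j * P j i)"
    using j rev by (intro sum.cong) auto
  then show ?thesis using rows[OF j] by (simp add: sum_distrib_left[symmetric])
qed

text \<open>Expanding the square and using stationarity for the \<open>f j\<close> terms leaves the
  quadratic form of \<open>I - s P\<close>. The choice \<open>s = 1\<close> is the Dirichlet form,
  which keeps eigenvalues at most 1. The choice \<open>s = -1\<close> controls them from
  below.\<close>

lemma reversible_energy:
  fixes P :: "nat \<Rightarrow> nat \<Rightarrow> real" and w f :: "nat \<Rightarrow> real" and s :: real
  assumes rev: "\<And>i j. i < n \<Longrightarrow> j < n \<Longrightarrow> w i * P i j = w j * P j i"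
    and rows: "\<And>i. i < n \<Longrightarrow> (\<Sum>j<n. P i j) = 1"
    and s: "s^2 = 1"
  shows "(\<Sum>i<n. \<Sum>j<n. w i * P i j * (f i - s * f j)^2)
    = 2 * ((\<Sum>i<n. w i * (f i * f i)) - s * (\<Sum>i<n. w i * f i * (\<Sum>j<n. P i j * f j)))"
proof -
  note cols = reversible_stationary[OF rev rows]
  have "(\<Sum>i<n. \<Sum>j<n. w i * P i j * (f i - s * f j)^2)
      = (\<Sum>i<n. \<Sum>j<n. w i * (f i * f i) * P i j + w i * P i j * (f j * f j) - 2 * s * (w i * f i * (P i j * f j)))"
  proof (intro sum.cong refl)
    fix i j
    have "(f i - s * f j)^2 = f i * f i + s^2 * (f j * f j) - 2 * s * (f i * f j)"
      by (simp add: power2_eq_square algebra_simps)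
    then have sq: "(f i - s * f j)^2 = f i * f i + f j * f j - 2 * s * (f i * f j)"
      by (simp add: s)
    show "w i * P i j * (f i - s * f j)^2
      = w i * (f i * f i) * P i j + w i * P i j * (f j * f j) - 2 * s * (w i * f i * (P i j * f j))"
      unfolding sq by (simp add: algebra_simps)
  qed
  also have "\<dots> = (\<Sum>i<n. w i * (f i * f i) * (\<Sum>j<n. P i j)) + (\<Sum>i<n. \<Sum>j<n. w i * P i j * (f j * f j))
      - 2 * s * (\<Sum>i<n. w i * f i * (\<Sum>j<n. P i j * f j))"
    by (simp add: sum.distrib sum_subtractf sum_distrib_left)
  also have "(\<Sum>i<n. \<Sum>j<n. w i * P i j * (f j * f j)) = (\<Sum>j<n. w j * (f j * f j))"
    by (subst sum.swap) (simp add: sum_distrib_right[symmetric] cols)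
  finally show ?thesis by (simp add: rows)
qed

lemma rtranclp_constant:
  assumes "R\<^sup>*\<^sup>* u v" and "\<And>x y. R x y \<Longrightarrow> f x = f y"
  shows "f u = f v"
  using assms by (induction rule: rtranclp_induct) auto

text \<open>The spectrum lies in the interval from -1 (excluded) to 1, and 1 is a simple eigenvalue,
  so every factor of \<open>R\<close> is positive. The second claim splits off the factor of the
  spectral gap and bounds all the others together by 4.\<close>

lemma reversible_eigenvalue_product:
  fixes P :: "nat \<Rightarrow> nat \<Rightarrow> real" and w :: "nat \<Rightarrow> real"
  assumes n2: "n \<ge> 2"
    and w: "\<And>i. i < n \<Longrightarrow> 0 < w i" and w1: "(\<Sum>i<n. w i) = 1"
    and rev: "\<And>i j. i < n \<Longrightarrow> j < n \<Longrightarrow> w i * P i j = w j * P j i"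
    and P0: "\<And>i j. i < n \<Longrightarrow> j < n \<Longrightarrow> 0 \<le> P i j"
    and diag: "\<And>i. i < n \<Longrightarrow> 0 < P i i"
    and rows: "\<And>i. i < n \<Longrightarrow> (\<Sum>j<n. P i j) = 1"
    and irr: "\<And>u v. u < n \<Longrightarrow> v < n \<Longrightarrow> (\<lambda>x y. x < n \<and> y < n \<and> P x y \<noteq> 0)\<^sup>*\<^sup>* u v"
    and tr: "1 \<le> (\<Sum>i<n. P i i)"
    and cp: "char_poly (mat n n (\<lambda>(i,j). P i j)) = (\<Prod>e\<leftarrow>ls. [:- e, 1:])"
    and len: "length ls = n"
    and ord: "\<And>i j. i \<le> j \<Longrightarrow> j < n \<Longrightarrow> \<bar>1 - ls ! i\<bar> \<le> \<bar>1 - ls ! j\<bar>"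
    and k: "k < n"
  defines "R \<equiv> \<Prod>ij\<in>({..<n} \<times> {..<n}) - {(0,0)}. (1 - ls ! fst ij * ls ! snd ij)"
  shows "0 < R" and "R * (1 - w k) \<le> 4 * (1 - P k k)"
proof -
  obtain f where
    orth: "\<And>l m. l < n \<Longrightarrow> m < n \<Longrightarrow> (\<Sum>i<n. w i * (f i l * f i m)) = (if l = m then 1 else 0)" and
    compl: "\<And>i j. i < n \<Longrightarrow> j < n \<Longrightarrow> (\<Sum>m<n. f i m * f j m) * w j = (if i = j then 1 else 0)" and
    eig: "\<And>i m. i < n \<Longrightarrow> m < n \<Longrightarrow> (\<Sum>j<n. P i j * f j m) = ls ! m * f i m"
    using reversible_eigenbasis[OF w rev cp len] by blast
  have energy: "(\<Sum>i<n. \<Sum>j<n. w i * P i j * (f i m - s * f j m)^2) = 2 * (1 - s * ls ! m)"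
    if "m < n" "s^2 = 1" for m s
  proof -
    have "(\<Sum>i<n. w i * f i m * (\<Sum>j<n. P i j * f j m)) = ls ! m * (\<Sum>i<n. w i * (f i m * f i m))"
      unfolding sum_distrib_left[of "ls ! m"] using that by (intro sum.cong) (auto simp: eig)
    then show ?thesis
      using reversible_energy[OF rev rows that(2), of "\<lambda>i. f i m"] orth[OF that(1,1)] by simp
  qed
  have term0: "0 \<le> w i * P i j * x^2" if "i < n" "j < n" for i j x
    using that w[of i] P0[of i j] by simp
  have le1: "ls ! m \<le> 1" if "m < n" for m
  proof -
    have "0 \<le> (\<Sum>i<n. \<Sum>j<n. w i * P i j * (f i m - 1 * f j m)^2)"
      by (intro sum_nonneg term0) auto
    then show ?thesis using energy[OF that, of 1] by simp
  qed
  \<comment> \<open>For \<open>s = -1\<close> the diagonal term at a vertex where the eigenvector is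
    nonzero is strictly positive, because \<open>P i i > 0\<close>.\<close>
  have gtm1: "-1 < ls ! m" if "m < n" for m
  proof -
    have "\<exists>i<n. f i m \<noteq> 0"
    proof (rule ccontr)
      assume "\<not> ?thesis"
      then have "(\<Sum>i<n. w i * (f i m * f i m)) = 0" by (intro sum.neutral) auto
      then show False using orth[OF that that] by simp
    qed
    then obtain i where i: "i < n" "f i m \<noteq> 0" by blast
    have "0 < w i * P i i * (f i m - (-1) * f i m)^2"
      using i w diag by simp
    also have "\<dots> \<le> (\<Sum>j<n. w i * P i j * (f i m - (-1) * f j m)^2)"
      using i by (intro member_le_sum term0) auto
    also have "\<dots> \<le> (\<Sum>i<n. \<Sum>j<n. w i * P i j * (f i m - (-1) * f j m)^2)"
      using i by (intro member_le_sum[of i "{..<n}" "\<lambda>i. \<Sum>j<n. w i * P i j * (f i m - (-1) * f j m)^2"]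
          sum_nonneg term0) auto
    finally show ?thesis using energy[OF that, of "-1"] by simp
  qed
  \<comment> \<open>For eigenvalue 1 the Dirichlet form vanishes, so the eigenvector agrees across
    every pair with \<open>P x y\<close> nonzero and is constant by irreducibility.\<close>
  have const: "f i m = f 0 m" if "m < n" "ls ! m = 1" "i < n" for i m
  proof -
    have z: "(\<Sum>i<n. \<Sum>j<n. w i * P i j * (f i m - 1 * f j m)^2) = 0"
      using energy[OF that(1), of 1] that by simp
    have "w x * P x y * (f x m - 1 * f y m)^2 = 0" if "x < n" "y < n" for x y
    proof -
      have "(\<Sum>j<n. w x * P x j * (f x m - 1 * f j m)^2) = 0"
        using z that by (subst (asm) sum_nonneg_eq_0_iff) (auto intro!: sum_nonneg term0[simplified])
      then show ?thesis using that
        by (subst (asm) sum_nonneg_eq_0_iff) (auto intro!: term0[simplified])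
    qed
    then have "f x m = f y m" if "x < n \<and> y < n \<and> P x y \<noteq> 0" for x y
      using that w[of x] by fastforce
    then show ?thesis using rtranclp_constant[OF irr[of i 0], of "\<lambda>i. f i m"] that by auto
  qed
  note cols = reversible_stationary[OF rev rows]
  \<comment> \<open>Otherwise stationarity makes the constant function 1 orthogonal to every
    eigenvector, while completeness expands it in this basis.\<close>
  have "\<exists>m<n. ls ! m = 1"
  proof (rule ccontr)
    assume no: "\<not> ?thesis"
    define c where "c m = (\<Sum>j<n. w j * f j m)" for m
    have "c m = 0" if "m < n" for m
    proof -
      have "ls ! m * c m = (\<Sum>i<n. w i * (\<Sum>j<n. P i j * f j m))"
        unfolding c_def sum_distrib_left[of "ls ! m"] using that by (intro sum.cong) (auto simp: eig)
      also have "\<dots> = (\<Sum>j<n. (\<Sum>i<n. w i * P i j) * f j m)"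
        unfolding sum_distrib_left sum_distrib_right by (subst sum.swap) (simp add: mult.assoc)
      also have "\<dots> = c m" by (simp add: cols c_def)
      finally show ?thesis using no that by auto
    qed
    then have "(\<Sum>m<n. f k m * c m) = 0" by simp
    also have "(\<Sum>m<n. f k m * c m) = (\<Sum>j<n. (\<Sum>m<n. f k m * f j m) * w j)"
      unfolding c_def sum_distrib_left sum_distrib_right
      by (subst sum.swap) (simp add: ac_simps)
    also have "\<dots> = 1" using k by (simp add: compl)
    finally show False by simp
  qed
  then obtain m1 where "m1 < n" "ls ! m1 = 1" by blast
  \<comment> \<open>The list is sorted by distance from 1, so an eigenvalue equal to 1 forces the
    first one to equal 1.\<close>
  then have l0: "ls ! 0 = 1" using ord[of 0 m1] by simp
  have const_prod: "(\<Sum>i<n. w i * (f i l * f i m)) = f 0 l * f 0 m"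
    if "l < n" "m < n" "ls ! l = 1" "ls ! m = 1" for l m
  proof -
    have "(\<Sum>i<n. w i * (f i l * f i m)) = (\<Sum>i<n. w i) * (f 0 l * f 0 m)"
      unfolding sum_distrib_right
    proof (intro sum.cong refl)
      fix i assume "i \<in> {..<n}"
      then show "w i * (f i l * f i m) = w i * (f 0 l * f 0 m)"
        using const[of l i] const[of m i] that by simp
    qed
    then show ?thesis by (simp add: w1)
  qed
  \<comment> \<open>A second eigenvalue 1 would give two normalised constant eigenvectors, and these
    cannot be orthogonal.\<close>
  have lt1: "ls ! m < 1" if m: "0 < m" "m < n" for m
  proof (rule ccontr)
    assume "\<not> ?thesis"
    then have one: "ls ! m = 1" using le1[of m] m by simp
    have "f 0 0 * f 0 m = 0" "f 0 0 * f 0 0 = 1" "f 0 m * f 0 m = 1"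
      using const_prod[of 0 m] const_prod[of 0 0] const_prod[of m m] one l0 m
        orth[of 0 m] orth[of 0 0] orth[of m m] by simp_all
    then show False by auto
  qed
  have le_l1: "ls ! m \<le> ls ! 1" if "0 < m" "m < n" for m
    using ord[of 1 m] lt1[of m] lt1[of 1] that by simp
  have Pdiag: "P i i = (\<Sum>m<n. ls ! m * (f i m * f i m * w i))" if i: "i < n" for i
  proof -
    have "P i i = (\<Sum>j<n. P i j * ((\<Sum>m<n. f j m * f i m) * w i))"
      using i by (simp add: compl sum_mult_delta)
    also have "\<dots> = (\<Sum>m<n. (\<Sum>j<n. P i j * f j m) * (f i m * w i))"
      unfolding sum_distrib_left sum_distrib_right by (subst sum.swap) (simp add: ac_simps)
    finally show ?thesis using i by (simp add: eig ac_simps)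
  qed
  have trace: "(\<Sum>m<n. ls ! m) = (\<Sum>i<n. P i i)"
  proof -
    have "(\<Sum>i<n. P i i) = (\<Sum>m<n. ls ! m * (\<Sum>i<n. w i * (f i m * f i m)))"
      unfolding sum_distrib_left by (subst sum.swap) (simp add: Pdiag ac_simps)
    then show ?thesis by (simp add: orth)
  qed
  have f0: "f k 0 * f k 0 = 1"
    using const_prod[of 0 0] const[of 0 k] orth[of 0 0] k l0 by simp
  \<comment> \<open>In the spectral expansion of \<open>1 - P k k\<close> the weights
    \<open>f k m * f k m * w k\<close> sum to 1. The term \<open>m = 0\<close> contributes nothing
    and has weight \<open>w k\<close>, and every other term has a factor at least
    \<open>1 - ls ! 1\<close>.\<close>
  have gap: "(1 - ls ! 1) * (1 - w k) \<le> 1 - P k k"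
  proof -
    have "1 - P k k = (\<Sum>m<n. (1 - ls ! m) * (f k m * f k m * w k))"
      using compl[OF k k] by (simp add: Pdiag[OF k] algebra_simps sum_subtractf sum_distrib_left)
    also have "\<dots> \<ge> (\<Sum>m<n. if m = 0 then 0 else (1 - ls ! 1) * (f k m * f k m * w k))"
      using w[OF k] le_l1 l0 by (intro sum_mono) (auto intro!: mult_right_mono)
    also have "(\<Sum>m<n. if m = 0 then 0 else (1 - ls ! 1) * (f k m * f k m * w k))
      = (\<Sum>m<n. (1 - ls ! 1) * (f k m * f k m * w k) - (if m = 0 then (1 - ls ! 1) * (f k 0 * f k 0 * w k) else 0))"
      by (intro sum.cong) auto
    also have "\<dots> = (1 - ls ! 1) * ((\<Sum>m<n. f k m * f k m) * w k) - (1 - ls ! 1) * (f k 0 * f k 0 * w k)"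
      using k by (simp add: sum_subtractf sum_distrib_left sum_distrib_right)
    also have "(\<Sum>m<n. f k m * f k m) * w k = 1" using compl[OF k k] by simp
    finally show ?thesis unfolding f0 by (simp add: algebra_simps)
  qed
  define I where "I = ({..<n} \<times> {..<n}) - {(0,0)}"
  \<comment> \<open>Since \<open>ls ! 0 = 1\<close>, the factor at \<open>(0,1)\<close> is exactly
    the spectral gap \<open>1 - ls ! 1\<close>.\<close>
  define I' where "I' = I - {(0,1)}"
  have fin: "finite I" "finite I'" by (auto simp: I_def I'_def)
  have in_I: "(0,1) \<in> I" using n2 by (auto simp: I_def)
  have pos: "0 < 1 - ls ! fst ij * ls ! snd ij" if ijI: "ij \<in> I" for ij
  proof -
    obtain i j where ij: "ij = (i,j)" "i < n" "j < n" "i \<noteq> 0 \<or> j \<noteq> 0" using ijI by (cases ij) (auto simp: I_def)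
    have b: "\<bar>ls ! i\<bar> \<le> 1" "\<bar>ls ! j\<bar> \<le> 1" using le1[OF ij(2)] gtm1[OF ij(2)] le1[OF ij(3)] gtm1[OF ij(3)] by simp_all
    have "\<bar>ls ! i\<bar> < 1 \<or> \<bar>ls ! j\<bar> < 1" using lt1[of i] lt1[of j] gtm1[OF ij(2)] gtm1[OF ij(3)] ij by auto
    then have "\<bar>ls ! i\<bar> * \<bar>ls ! j\<bar> < 1"
    proof
      assume "\<bar>ls ! i\<bar> < 1"
      then show ?thesis using mult_left_mono[OF b(2), of "\<bar>ls ! i\<bar>"] by simp
    next
      assume "\<bar>ls ! j\<bar> < 1"
      then show ?thesis using mult_right_mono[OF b(1), of "\<bar>ls ! j\<bar>"] by simp
    qed
    then show ?thesis using ij abs_ge_self[of "ls ! i * ls ! j"] by (simp add: abs_mult)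
  qed
  show Pi_pos: "0 < R" unfolding R_def using pos by (intro prod_pos) (auto simp: I_def)
  have R_split: "R = (1 - ls ! 1) * (\<Prod>ij\<in>I'. 1 - ls ! fst ij * ls ! snd ij)"
    unfolding R_def I_def[symmetric] I'_def by (subst prod.remove[OF fin(1) in_I]) (simp add: l0)
  have rest: "(\<Prod>ij\<in>I'. 1 - ls ! fst ij * ls ! snd ij) \<le> 4"
  proof -
    have "(\<Prod>ij\<in>I'. 1 - ls ! fst ij * ls ! snd ij) \<le> (\<Prod>ij\<in>I'. exp (- (ls ! fst ij * ls ! snd ij)))"
      using pos by (intro prod_mono) (auto simp: I'_def less_imp_le intro: order_trans[OF _ exp_ge_add_one_self])
    also have "\<dots> = exp (- (\<Sum>ij\<in>I'. ls ! fst ij * ls ! snd ij))"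
      by (simp add: exp_sum fin sum_negf[symmetric])
    \<comment> \<open>The sum over the full square is the squared trace. The removed pairs
      \<open>(0,0)\<close> and \<open>(0,1)\<close> account for 1 and \<open>ls ! 1\<close>.\<close>
    also have "(\<Sum>ij\<in>I'. ls ! fst ij * ls ! snd ij) = (\<Sum>m<n. ls ! m)^2 - 1 - ls ! 1"
    proof -
      have "(\<Sum>m<n. ls ! m)^2 = (\<Sum>ij\<in>{..<n}\<times>{..<n}. ls ! fst ij * ls ! snd ij)"
        by (simp add: power2_eq_square sum_product sum.cartesian_product case_prod_beta)
      also have "\<dots> = 1 + (\<Sum>ij\<in>I. ls ! fst ij * ls ! snd ij)"
        unfolding I_def using n2 l0 by (subst sum.remove[of _ "(0,0)"]) auto
      also have "(\<Sum>ij\<in>I. ls ! fst ij * ls ! snd ij) = ls ! 1 + (\<Sum>ij\<in>I'. ls ! fst ij * ls ! snd ij)"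
        unfolding I'_def using fin in_I l0 by (subst sum.remove[of _ "(0,1)"]) auto
      finally show ?thesis by simp
    qed
    also have "exp (- ((\<Sum>m<n. ls ! m)^2 - 1 - ls ! 1)) \<le> exp 1"
      using one_le_power[OF tr, of 2] le1[of 1] n2 by (simp add: trace)
    also have "\<dots> \<le> 4" using exp_le by simp
    finally show ?thesis .
  qed
  have "R \<le> (1 - ls ! 1) * 4"
    unfolding R_split using le1[of 1] n2 by (intro mult_left_mono[OF rest]) simp
  moreover have "w k \<le> 1" using member_le_sum[of k "{..<n}" w] w w1 k by (auto simp: less_imp_le)
  ultimately have "R * (1 - w k) \<le> (1 - ls ! 1) * 4 * (1 - w k)" by (intro mult_right_mono) auto
  also have "\<dots> \<le> 4 * (1 - P k k)" using gap by (simp add: algebra_simps)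
  finally show "R * (1 - w k) \<le> 4 * (1 - P k k)" .
qed

section \<open>Independent coins\<close>

text \<open>Dependence on coins is expressed pointwise instead of through a generated sigma-algebra.
  For a finite set of measurable coins this alone yields measurability and boundedness, and closure
  under arithmetic is immediate.\<close>

definition determined_by :: "('i \<Rightarrow> 'w \<Rightarrow> bool) \<Rightarrow> 'i set \<Rightarrow> ('w \<Rightarrow> real) \<Rightarrow> bool" where
  "determined_by X J Y \<longleftrightarrow> (\<forall>\<omega> \<omega>'. (\<forall>i\<in>J. X i \<omega> = X i \<omega>') \<longrightarrow> Y \<omega> = Y \<omega>')"

lemma determined_by_mono: "determined_by X J Y \<Longrightarrow> J \<subseteq> K \<Longrightarrow> determined_by X K Y"
  unfolding determined_by_def by blast

lemma determined_by_comp2: "determined_by X J Y \<Longrightarrow> determined_by X J Z \<Longrightarrow> determined_by X J (\<lambda>\<omega>. f (Y \<omega>) (Z \<omega>))"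
  unfolding determined_by_def by metis

lemma determined_by_comp: "determined_by X J Y \<Longrightarrow> determined_by X J (\<lambda>\<omega>. f (Y \<omega>))"
  unfolding determined_by_def by metis

lemma determined_by_sum: "(\<And>j. j \<in> K \<Longrightarrow> determined_by X J (Y j)) \<Longrightarrow> determined_by X J (\<lambda>\<omega>. \<Sum>j\<in>K. Y j \<omega>)"
  unfolding determined_by_def by (auto intro!: sum.cong)

text \<open>The factor map evaluates \<open>Y\<close> at a chosen outcome that shows the given coin
  pattern. The choice is irrelevant because \<open>Y\<close> agrees on all such outcomes.\<close>

lemma determined_by_factor:
  assumes "determined_by X J Y"
  obtains F where "\<And>\<omega>. Y \<omega> = F (restrict (\<lambda>i. X i \<omega>) J)"
proof
  fix \<omega>
  define \<omega>' where "\<omega>' = (SOME \<omega>'. restrict (\<lambda>i. X i \<omega>') J = restrict (\<lambda>i. X i \<omega>) J)"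
  have "restrict (\<lambda>i. X i \<omega>') J = restrict (\<lambda>i. X i \<omega>) J"
    unfolding \<omega>'_def by (rule someI[of _ \<omega>]) simp
  then have "\<forall>i\<in>J. X i \<omega> = X i \<omega>'" by (metis restrict_apply')
  then show "Y \<omega> = (\<lambda>z. Y (SOME \<omega>'. restrict (\<lambda>i. X i \<omega>') J = z)) (restrict (\<lambda>i. X i \<omega>) J)"
    using assms unfolding determined_by_def \<omega>'_def by blast
qed

lemma PiM_bool:
  "finite J \<Longrightarrow> PiM J (\<lambda>_. count_space (UNIV :: bool set)) = count_space (PiE J (\<lambda>_. UNIV))"
  by (rule count_space_PiM_finite) (auto intro: countable_finite)

context prob_space
begin

lemma measurable_coins:
  assumes "\<And>i. i \<in> J \<Longrightarrow> X i \<in> measurable M (count_space UNIV)"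
  shows "(\<lambda>\<omega>. restrict (\<lambda>i. X i \<omega>) J) \<in> measurable M (PiM J (\<lambda>_. count_space UNIV))"
  using assms by (intro measurable_restrict) auto

lemma borel_measurable_PiM_bool:
  fixes F :: "('i \<Rightarrow> bool) \<Rightarrow> real"
  shows "finite J \<Longrightarrow> F \<in> borel_measurable (PiM J (\<lambda>_. count_space UNIV))"
  by (simp add: PiM_bool)

text \<open>A function of finitely many coins takes finitely many values; the sum of their absolute
  values over all patterns serves as the bound.\<close>

lemma integrable_determined:
  assumes J: "finite J" "\<And>i. i \<in> J \<Longrightarrow> X i \<in> measurable M (count_space UNIV)"
    and det: "determined_by X J Y"
  shows "integrable M Y"
proof -
  obtain F where F: "\<And>\<omega>. Y \<omega> = F (restrict (\<lambda>i. X i \<omega>) J)"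
    using determined_by_factor[OF det] by blast
  have fin: "finite (PiE J (\<lambda>_. UNIV :: bool set))" using J(1) by (intro finite_PiE) auto
  define C where "C = (\<Sum>z\<in>PiE J (\<lambda>_. UNIV). \<bar>F z\<bar>)"
  have "\<bar>Y \<omega>\<bar> \<le> C" for \<omega>
    unfolding F C_def using fin by (intro member_le_sum) auto
  moreover have "Y \<in> borel_measurable M"
    unfolding F by (rule measurable_compose[OF measurable_coins[OF J(2)] borel_measurable_PiM_bool[OF J(1)]])
  ultimately show ?thesis by (intro integrable_const_bound[of _ C]) auto
qed

lemma expectation_mult_determined:
  assumes ind: "indep_vars (\<lambda>_. count_space UNIV) X I"
    and J: "finite J" "finite K" "J \<subseteq> I" "K \<subseteq> I" "J \<inter> K = {}"
    and det: "determined_by X J Y" "determined_by X K Z"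
  shows "expectation (\<lambda>\<omega>. Y \<omega> * Z \<omega>) = expectation Y * expectation Z"
proof -
  have meas: "X i \<in> measurable M (count_space UNIV)" if "i \<in> I" for i
    using ind that by (auto simp: indep_vars_def)
  obtain F G where F: "Y = (\<lambda>\<omega>. F (restrict (\<lambda>i. X i \<omega>) J))" and G: "Z = (\<lambda>\<omega>. G (restrict (\<lambda>i. X i \<omega>) K))"
    using determined_by_factor[OF det(1)] determined_by_factor[OF det(2)] by (metis ext)
  have "indep_var borel (F \<circ> (\<lambda>\<omega>. restrict (\<lambda>i. X i \<omega>) J)) borel (G \<circ> (\<lambda>\<omega>. restrict (\<lambda>i. X i \<omega>) K))"
    using J meas by (intro indep_var_compose[OF indep_var_restrict[OF ind]] borel_measurable_PiM_bool) auto
  then have "indep_var borel Y borel Z" by (simp add: F G comp_def)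
  then show ?thesis
    using J meas det by (intro indep_var_lebesgue_integral integrable_determined) auto
qed

end

text \<open>The mean of \<open>g\<close> at a binomial variable with parameters \<open>m\<close> and
  \<open>p\<close>, given by conditioning on one coin at a time. This form matches induction over a
  set of coins.\<close>

primrec binomial_mean :: "real \<Rightarrow> nat \<Rightarrow> (nat \<Rightarrow> real) \<Rightarrow> real" where
  "binomial_mean p 0 g = g 0"
| "binomial_mean p (Suc m) g = p * binomial_mean p m (\<lambda>k. g (Suc k)) + (1 - p) * binomial_mean p m g"

lemma binomial_mean_add: "binomial_mean p m (\<lambda>k. g k + h k) = binomial_mean p m g + binomial_mean p m h"
  by (induction m arbitrary: g h) (simp_all add: algebra_simps)

lemma binomial_mean_positive:
  assumes "0 < p" "p < 1" "\<And>k. 0 < g k"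
  shows "0 < binomial_mean p m g"
  using assms(3) by (induction m arbitrary: g) (use assms(1,2) in \<open>simp_all add: add_pos_pos\<close>)

text \<open>Size biasing: each of the \<open>m\<close> coins contributes \<open>p\<close> times the
  mean over the other \<open>m - 1\<close> coins with this one counted as a success. At
  \<open>m = 0\<close> both sides are 0.\<close>

lemma binomial_mean_size_bias:
  "binomial_mean p m (\<lambda>k. real k * h k) = real m * p * binomial_mean p (m - 1) (\<lambda>k. h (Suc k))"
proof (induction m arbitrary: h)
  case (Suc m)
  have "binomial_mean p m (\<lambda>k. real (Suc k) * h (Suc k))
      = binomial_mean p m (\<lambda>k. real k * h (Suc k)) + binomial_mean p m (\<lambda>k. h (Suc k))"
    by (simp add: binomial_mean_add[symmetric] distrib_right add.commute)
  then have "binomial_mean p (Suc m) (\<lambda>k. real k * h k)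
      = p * binomial_mean p m (\<lambda>k. h (Suc k))
        + real m * p * (p * binomial_mean p (m - 1) (\<lambda>k. h (Suc (Suc k))) + (1 - p) * binomial_mean p (m - 1) (\<lambda>k. h (Suc k)))"
    by (simp only: binomial_mean.simps Suc.IH) (simp add: algebra_simps)
  also have "\<dots> = p * binomial_mean p m (\<lambda>k. h (Suc k)) + real m * p * binomial_mean p m (\<lambda>k. h (Suc k))"
    by (cases m) simp_all
  finally show ?case by (simp add: algebra_simps)
qed simp

lemma binomial_mean_pos: "binomial_mean p m (\<lambda>k. if k = 0 then 0 else 1) = 1 - (1 - p) ^ m"
proof (induction m)
  case (Suc m)
  have one: "binomial_mean p m (\<lambda>_. 1) = 1" by (induction m) simp_all
  show ?case by (simp add: Suc.IH one) (simp add: algebra_simps)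
qed simp

text \<open>Size biasing with \<open>h k = 1 / k\<close> on \<open>m + 1\<close> coins. As
  \<open>1 / 0\<close> is 0, the product \<open>k * (1 / k)\<close> is the indicator of at least one
  success.\<close>

lemma binomial_mean_inverse_Suc:
  assumes "p \<noteq> 0"
  shows "binomial_mean p m (\<lambda>k. 1 / (real k + 1)) = (1 - (1 - p) ^ (m + 1)) / (p * (real m + 1))"
proof -
  have "(\<lambda>k. real k * (1 / real k)) = (\<lambda>k. if k = 0 then 0 else 1)" by auto
  then have "1 - (1 - p) ^ (m + 1) = binomial_mean p m (\<lambda>k. 1 / (real k + 1)) * (p * (real m + 1))"
    using binomial_mean_size_bias[of p "m + 1" "\<lambda>k. 1 / real k"] binomial_mean_pos[of p "m + 1"]
    by (simp add: add.commute mult_ac)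
  moreover have "real m + 1 \<noteq> 0" using of_nat_0_le_iff[of m] by linarith
  ultimately show ?thesis using assms by (subst eq_divide_eq) auto
qed

lemma (in prob_space) expectation_count_coins:
  assumes J: "finite J"
    and ind: "indep_vars (\<lambda>_. count_space UNIV) X J"
    and pr: "\<And>j. j \<in> J \<Longrightarrow> prob {\<omega> \<in> space M. X j \<omega>} = p"
  shows "expectation (\<lambda>\<omega>. g (card {j\<in>J. X j \<omega>})) = binomial_mean p (card J) g"
  using J ind pr
proof (induction J arbitrary: g rule: finite_induct)
  case empty
  then show ?case by (simp add: prob_space)
next
  case (insert j J)
  have indJ: "indep_vars (\<lambda>_. count_space UNIV) X J"
    using insert.prems(1) by (rule indep_vars_subset) auto
  have meas: "X i \<in> measurable M (count_space UNIV)" if "i \<in> insert j J" for i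
    using insert.prems(1) that unfolding indep_vars_def by blast
  have IH: "expectation (\<lambda>\<omega>. g (card {j\<in>J. X j \<omega>})) = binomial_mean p (card J) g" for g
    using insert.IH[OF indJ] insert.prems(2) by simp
  have Jdet: "determined_by X J (\<lambda>\<omega>. g (card {j\<in>J. X j \<omega>}))" for g
    unfolding determined_by_def by (auto intro!: arg_cong[of _ _ g] arg_cong[of _ _ card])
  have jdet: "determined_by X {j} (\<lambda>\<omega>. of_bool (X j \<omega>))" "determined_by X {j} (\<lambda>\<omega>. 1 - of_bool (X j \<omega>))"
    by (auto simp: determined_by_def)
  have int: "integrable M (\<lambda>\<omega>. of_bool (X j \<omega>) :: real)"
    using meas by (intro integrable_determined[OF _ _ jdet(1)]) auto
  have Ej: "expectation (\<lambda>\<omega>. of_bool (X j \<omega>)) = p"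
  proof -
    have "expectation (\<lambda>\<omega>. of_bool (X j \<omega>)) = expectation (indicator {\<omega> \<in> space M. X j \<omega>})"
      by (intro Bochner_Integration.integral_cong) (auto simp: indicator_def)
    also have "\<dots> = prob {\<omega> \<in> space M. X j \<omega>}"
      by (simp add: Int_absorb2 subset_eq)
    finally show ?thesis using insert.prems(2) by simp
  qed
  have split: "g (card {i\<in>insert j J. X i \<omega>})
      = of_bool (X j \<omega>) * g (Suc (card {i\<in>J. X i \<omega>})) + (1 - of_bool (X j \<omega>)) * g (card {i\<in>J. X i \<omega>})" for \<omega>
  proof (cases "X j \<omega>")
    case True
    then have "{i\<in>insert j J. X i \<omega>} = insert j {i\<in>J. X i \<omega>}" by auto
    then show ?thesis using True insert.hyps by simp
  next
    case False
    then have "{i\<in>insert j J. X i \<omega>} = {i\<in>J. X i \<omega>}" by auto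
    then show ?thesis using False by simp
  qed
  have prod1: "expectation (\<lambda>\<omega>. of_bool (X j \<omega>) * g (Suc (card {i\<in>J. X i \<omega>}))) = p * binomial_mean p (card J) (\<lambda>k. g (Suc k))"
    using expectation_mult_determined[OF insert.prems(1) _ _ _ _ _ jdet(1) Jdet[of "\<lambda>k. g (Suc k)"]]
      insert.hyps IH[of "\<lambda>k. g (Suc k)"] Ej by auto
  have prod2: "expectation (\<lambda>\<omega>. (1 - of_bool (X j \<omega>)) * g (card {i\<in>J. X i \<omega>})) = (1 - p) * binomial_mean p (card J) g"
    using expectation_mult_determined[OF insert.prems(1) _ _ _ _ _ jdet(2) Jdet[of g]]
      insert.hyps IH[of g] Ej int by (auto simp: prob_space)
  have i1: "integrable M (\<lambda>\<omega>. of_bool (X j \<omega>) * g (Suc (card {i\<in>J. X i \<omega>})))"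
   and i2: "integrable M (\<lambda>\<omega>. (1 - of_bool (X j \<omega>)) * g (card {i\<in>J. X i \<omega>}))"
    using insert.hyps meas jdet(1) Jdet
    by (auto intro!: integrable_determined[of "insert j J" X] simp: determined_by_def intro!: arg_cong[of _ _ g] arg_cong[of _ _ card])
  show ?case
    unfolding split using insert.hyps i1 i2 prod1 prod2
    by (subst Bochner_Integration.integral_add) auto
qed

section \<open>The averaging dynamics\<close>

locale gossip = prob_space M for M :: "'w measure" +
  fixes n :: nat and a :: "nat \<Rightarrow> nat \<Rightarrow> real" and p :: "nat \<Rightarrow> real"
    and B :: "nat \<Rightarrow> nat \<Rightarrow> nat \<Rightarrow> 'w \<Rightarrow> bool" and x0 :: "nat \<Rightarrow> real"
  assumes n2: "n \<ge> 2"
    and graph: "adj_graph n a"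
    and conn: "graph_connected n a"
    and degpos: "\<And>v. v < n \<Longrightarrow> deg n a v \<ge> 1"
    and p01: "\<And>v. v < n \<Longrightarrow> 0 < p v \<and> p v < 1"
    and Bindep: "indep_vars (\<lambda>_. count_space UNIV) (\<lambda>(k,u,v). B k u v) (UNIV \<times> {..<n} \<times> {..<n})"
    and Bprob: "\<And>k u v. u < n \<Longrightarrow> v < n \<Longrightarrow> prob {\<omega> \<in> space M. B k u v \<omega>} = p v"
begin

abbreviation coin :: "nat \<times> nat \<times> nat \<Rightarrow> 'w \<Rightarrow> bool" where
  "coin \<equiv> \<lambda>(k,u,v). B k u v"

definition nbrs :: "nat \<Rightarrow> nat set" where
  "nbrs i = {u\<in>{..<n}. a u i \<noteq> 0}"

definition active :: "nat \<Rightarrow> nat \<Rightarrow> 'w \<Rightarrow> nat" where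
  "active k i \<omega> = card {u\<in>nbrs i. B k u i \<omega>}"

text \<open>Because the averaging matrix involves the transpose of the random adjacency matrix,
  entry \<open>(i,j)\<close> reads the coin of the pair \<open>(j,i)\<close>.\<close>

definition W :: "nat \<Rightarrow> nat \<Rightarrow> nat \<Rightarrow> 'w \<Rightarrow> real" where
  "W k i j \<omega> = ((if j = i then 1 else 0) + atil a B k j i \<omega>) / (real (active k i \<omega>) + 1)"

definition P :: "nat \<Rightarrow> nat \<Rightarrow> real" where
  "P i j = (if i = j then M1 n a p i else 0) + (1 - M1 n a p i) * a j i / deg n a i"

abbreviation x :: "nat \<Rightarrow> nat \<Rightarrow> 'w \<Rightarrow> real" where
  "x k i \<omega> \<equiv> xdyn n a B x0 k \<omega> i"

lemma a01: "u < n \<Longrightarrow> v < n \<Longrightarrow> a u v = 0 \<or> a u v = 1"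
  and a_sym: "u < n \<Longrightarrow> v < n \<Longrightarrow> a u v = a v u"
  and a_diag: "u < n \<Longrightarrow> a u u = 0"
  using graph by (auto simp: adj_graph_def)

lemma a_nbrs: "u < n \<Longrightarrow> i < n \<Longrightarrow> a u i = of_bool (u \<in> nbrs i)"
  using a01 by (auto simp: nbrs_def)

lemma nbrs: "finite (nbrs i)" "nbrs i \<subseteq> {..<n}" "i < n \<Longrightarrow> i \<notin> nbrs i"
  by (auto simp: nbrs_def a_diag)

lemma sum_of_bool_nbrs: "(\<Sum>u<n. of_bool (u \<in> nbrs i \<and> Q u)) = real (card {u\<in>nbrs i. Q u})"
proof -
  have "{u\<in>nbrs i. Q u} = {u\<in>{..<n}. u \<in> nbrs i \<and> Q u}" using nbrs(2) by auto
  then show ?thesis by (simp add: of_bool_def sum.If_cases Int_def)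
qed

lemma deg_nbrs: "i < n \<Longrightarrow> deg n a i = real (card (nbrs i))"
  using sum_of_bool_nbrs[of i "\<lambda>_. True"] by (simp add: deg_def a_nbrs)

lemma card_nbrs: assumes "i < n" shows "0 < card (nbrs i)" "card (nbrs i) \<le> n - 1"
proof -
  show "0 < card (nbrs i)" using degpos[OF assms] deg_nbrs[OF assms] by simp
  have "card (nbrs i) \<le> card ({..<n} - {i})" using nbrs assms by (intro card_mono) auto
  then show "card (nbrs i) \<le> n - 1" using assms by simp
qed

lemma atil_nbrs: "u < n \<Longrightarrow> i < n \<Longrightarrow> atil a B k u i \<omega> = of_bool (u \<in> nbrs i \<and> B k u i \<omega>)"
  by (simp add: atil_def a_nbrs)

lemma sum_atil: "i < n \<Longrightarrow> (\<Sum>u<n. atil a B k u i \<omega>) = real (active k i \<omega>)"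
  by (simp add: atil_nbrs sum_of_bool_nbrs active_def)

lemma active_le: assumes "i < n" shows "active k i \<omega> \<le> n - 1"
proof -
  have "active k i \<omega> \<le> card (nbrs i)" unfolding active_def using nbrs by (intro card_mono) auto
  then show ?thesis using card_nbrs[OF assms] by simp
qed

lemma real_Suc_pos: "0 < real m + 1" "real m + 1 \<noteq> 0"
  by (simp_all add: add_nonneg_pos)

lemma W_nonneg: "i < n \<Longrightarrow> j < n \<Longrightarrow> 0 \<le> W k i j \<omega>"
  by (simp add: W_def atil_nbrs)

lemma W_diag: "i < n \<Longrightarrow> W k i i \<omega> = 1 / (real (active k i \<omega>) + 1)"
  using nbrs(3) by (simp add: W_def atil_nbrs)

lemma W_off: "i < n \<Longrightarrow> j < n \<Longrightarrow> i \<noteq> j \<Longrightarrow> W k i j \<omega> = of_bool (j \<in> nbrs i \<and> B k j i \<omega>) / (real (active k i \<omega>) + 1)"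
  by (simp add: W_def atil_nbrs)

lemma W_row_sum: assumes "i < n" shows "(\<Sum>j<n. W k i j \<omega>) = 1"
  using assms real_Suc_pos(2)[of "active k i \<omega>"]
  by (simp add: W_def sum_divide_distrib[symmetric] sum.distrib sum_atil add.commute)

text \<open>Every entry of the row is 0 or the reciprocal of the denominator, so squaring an entry
  multiplies it by that reciprocal, and the row sums to 1.\<close>

lemma W_row_sq: assumes "i < n" shows "(\<Sum>j<n. (W k i j \<omega>)^2) = 1 / (real (active k i \<omega>) + 1)"
proof -
  define c where "c = real (active k i \<omega>) + 1"
  have c: "c > 0" by (simp add: c_def real_Suc_pos)
  have "(\<Sum>j<n. (W k i j \<omega>)^2) = (\<Sum>j<n. W k i j \<omega> * (1 / c))"
  proof (intro sum.cong refl)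
    fix j assume "j \<in> {..<n}"
    then show "(W k i j \<omega>)^2 = W k i j \<omega> * (1 / c)"
      using assms nbrs(3)[OF assms] by (auto simp: W_def atil_nbrs power2_eq_square c_def)
  qed
  then show ?thesis using W_row_sum[OF assms] by (simp add: sum_distrib_right[symmetric] c_def sum_divide_distrib[symmetric])
qed

lemma W_diag_ge: assumes "i < n" shows "1 / real n \<le> W k i i \<omega>"
proof -
  have "real (active k i \<omega>) + 1 \<le> real n" using active_le[OF assms, of k \<omega>] n2 by linarith
  then show ?thesis unfolding W_diag[OF assms] using real_Suc_pos(1) by (intro divide_left_mono) auto
qed

lemma x_Suc: assumes "i < n" shows "x (Suc k) i \<omega> = (\<Sum>j<n. W (Suc k) i j \<omega> * x k j \<omega>)"
proof -
  have "(\<Sum>j<n. W (Suc k) i j \<omega> * x k j \<omega>)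
      = (\<Sum>j<n. (if j = i then x k i \<omega> else 0) + atil a B (Suc k) j i \<omega> * x k j \<omega>) / (real (active (Suc k) i \<omega>) + 1)"
    unfolding sum_divide_distrib by (intro sum.cong) (auto simp: W_def add_divide_distrib distrib_right)
  then show ?thesis using assms by (simp add: sum_atil sum.distrib)
qed

lemma coin_measurable: "i \<in> UNIV \<times> {..<n} \<times> {..<n} \<Longrightarrow> coin i \<in> measurable M (count_space UNIV)"
  using Bindep unfolding indep_vars_def by blast

definition past :: "nat \<Rightarrow> (nat \<times> nat \<times> nat) set" where
  "past k = {..k} \<times> {..<n} \<times> {..<n}"

text \<open>These contain all coins read by row \<open>i\<close> of the matrix at time
  \<open>k\<close>. They are disjoint for different vertices and from all earlier coins.\<close>

definition row :: "nat \<Rightarrow> nat \<Rightarrow> (nat \<times> nat \<times> nat) set" where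
  "row k i = {k} \<times> {..<n} \<times> {i}"

lemma W_det: assumes "i < n" "j < n" shows "determined_by coin (row k i) (W k i j)"
  unfolding determined_by_def
proof (intro allI impI)
  fix \<omega> \<omega>' assume "\<forall>c\<in>row k i. coin c \<omega> = coin c \<omega>'"
  then have eq: "B k u i \<omega> = B k u i \<omega>'" if "u < n" for u using that by (auto simp: row_def)
  then have "active k i \<omega> = active k i \<omega>'"
    unfolding active_def using nbrs(2) by (intro arg_cong[of _ _ card]) blast
  then show "W k i j \<omega> = W k i j \<omega>'" using assms eq by (simp add: W_def atil_def)
qed

lemma x_det: "i < n \<Longrightarrow> determined_by coin (past k) (x k i)"
proof (induction k arbitrary: i)
  case 0
  then show ?case by (simp add: determined_by_def)
next
  case (Suc k)
  have eq: "x (Suc k) i = (\<lambda>\<omega>. \<Sum>j<n. W (Suc k) i j \<omega> * x k j \<omega>)"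
    using x_Suc[OF Suc.prems] by auto
  show ?case unfolding eq
  proof (intro determined_by_sum determined_by_comp2[of _ _ _ _ "(*)"])
    fix j assume "j \<in> {..<n}"
    then have j: "j < n" by simp
    show "determined_by coin (past (Suc k)) (W (Suc k) i j)"
      using W_det[OF Suc.prems j] by (rule determined_by_mono) (use Suc.prems in \<open>auto simp: row_def past_def\<close>)
    show "determined_by coin (past (Suc k)) (x k j)"
      using Suc.IH[OF j] by (rule determined_by_mono) (auto simp: past_def)
  qed
qed

lemma past_finite [simp]: "finite (past k)" and past_sub: "past k \<subseteq> UNIV \<times> {..<n} \<times> {..<n}"
  by (auto simp: past_def)

lemma row_finite [simp]: "finite (row k i)" and row_sub: "i < n \<Longrightarrow> row k i \<subseteq> UNIV \<times> {..<n} \<times> {..<n}"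
  by (auto simp: row_def)

lemma integrable_det:
  assumes "finite J" "J \<subseteq> UNIV \<times> {..<n} \<times> {..<n}" "determined_by coin J Y"
  shows "integrable M Y"
  using assms coin_measurable by (intro integrable_determined[of J coin Y]) blast+

lemmas mult_det = expectation_mult_determined[OF Bindep]

lemma expectation_active: assumes "i < n"
  shows "expectation (\<lambda>\<omega>. 1 / (real (active k i \<omega>) + 1)) = M1 n a p i"
proof -
  let ?J = "(\<lambda>u. (k,u,i)) ` nbrs i"
  have ind: "indep_vars (\<lambda>_. count_space UNIV) coin ?J"
    using Bindep by (rule indep_vars_subset) (use nbrs(2) assms in auto)
  have card: "card ?J = card (nbrs i)" by (rule card_image) (auto intro: inj_onI)
  have act: "active k i \<omega> = card {c\<in>?J. coin c \<omega>}" for \<omega>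
  proof -
    have "{c\<in>?J. coin c \<omega>} = (\<lambda>u. (k,u,i)) ` {u\<in>nbrs i. B k u i \<omega>}" by auto
    then show ?thesis by (simp add: active_def card_image inj_on_def)
  qed
  have "expectation (\<lambda>\<omega>. 1 / (real (active k i \<omega>) + 1)) = binomial_mean (p i) (card ?J) (\<lambda>m. 1 / (real m + 1))"
    unfolding act
    by (rule expectation_count_coins[OF _ ind, where g = "\<lambda>m. 1 / (real m + 1)"])
       (use nbrs Bprob assms in \<open>auto simp: nbrs_def\<close>)
  also have "\<dots> = M1 n a p i"
    using p01[OF assms] by (simp add: binomial_mean_inverse_Suc M1_def card deg_nbrs[OF assms])
  finally show ?thesis .
qed

text \<open>The entry is nonzero only if the coin of \<open>j\<close> succeeds, and then its
  denominator is 2 plus the number of other active neighbours, which is independent of that coin.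
  What matters later is that the value is positive and the same for all neighbours
  \<open>j\<close>.\<close>

lemma expectation_W_off_eq:
  assumes i: "i < n" and j: "j \<in> nbrs i"
  shows "expectation (W k i j) = p i * binomial_mean (p i) (card (nbrs i) - 1) (\<lambda>m. 1 / (real m + 2))"
proof -
  let ?J = "(\<lambda>u. (k,u,i)) ` (nbrs i - {j})"
  have jn: "j < n" "j \<noteq> i" using j nbrs i by auto
  have ind: "indep_vars (\<lambda>_. count_space UNIV) coin ?J"
    using Bindep by (rule indep_vars_subset) (use nbrs(2) i in auto)
  have card: "card ?J = card (nbrs i) - 1"
    using j nbrs(1) by (subst card_image) (auto intro: inj_onI)
  let ?Y = "\<lambda>\<omega>. of_bool (B k j i \<omega>) :: real"
  let ?Z = "\<lambda>\<omega>. 1 / (real (card {c\<in>?J. coin c \<omega>}) + 2)"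
  have W: "W k i j = (\<lambda>\<omega>. ?Y \<omega> * ?Z \<omega>)"
  proof
    fix \<omega>
    show "W k i j \<omega> = ?Y \<omega> * ?Z \<omega>"
    proof (cases "B k j i \<omega>")
      case True
      have "{c\<in>?J. coin c \<omega>} = (\<lambda>u. (k,u,i)) ` {u\<in>nbrs i - {j}. B k u i \<omega>}" by auto
      then have "card {c\<in>?J. coin c \<omega>} = card {u\<in>nbrs i - {j}. B k u i \<omega>}"
        by (simp add: card_image inj_on_def)
      moreover have "{u\<in>nbrs i. B k u i \<omega>} = insert j {u\<in>nbrs i - {j}. B k u i \<omega>}"
        using True j by auto
      ultimately have "active k i \<omega> = Suc (card {c\<in>?J. coin c \<omega>})"
        unfolding active_def using nbrs(1) by simp
      then show ?thesis using True jn i j by (simp add: W_off add.commute)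
    qed (use jn i in \<open>simp add: W_off\<close>)
  qed
  have "expectation (\<lambda>\<omega>. ?Y \<omega> * ?Z \<omega>) = expectation ?Y * expectation ?Z"
  proof (rule mult_det[of "{(k,j,i)}" ?J])
    show "determined_by coin ?J ?Z"
      unfolding determined_by_def
      by (intro allI impI arg_cong[of _ _ "\<lambda>S. 1 / (real (card S) + 2)"]) blast
  qed (use nbrs i jn in \<open>auto simp: determined_by_def\<close>)
  also have "expectation ?Z = binomial_mean (p i) (card ?J) (\<lambda>m. 1 / (real m + 2))"
    by (rule expectation_count_coins[OF _ ind, where g = "\<lambda>m. 1 / (real m + 2)"])
       (use nbrs Bprob i in \<open>auto simp: nbrs_def\<close>)
  also have "expectation ?Y = p i"
  proof -
    have "expectation ?Y = expectation (indicator {\<omega> \<in> space M. B k j i \<omega>})"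
      by (intro Bochner_Integration.integral_cong) (auto simp: indicator_def)
    then show ?thesis using Bprob[OF jn(1) i] by (simp add: Int_absorb2 subset_eq)
  qed
  finally show ?thesis by (simp add: W card)
qed

lemma W_integrable: "i < n \<Longrightarrow> j < n \<Longrightarrow> integrable M (W k i j)"
  by (rule integrable_det[OF _ row_sub W_det]) auto

text \<open>All neighbours share one mean \<open>c\<close>. Rows of the random matrix sum to 1 and
  the diagonal mean is known, so \<open>c\<close> follows without evaluating the binomial
  expression.\<close>

lemma expectation_W: assumes i: "i < n" and j: "j < n" shows "expectation (W k i j) = P i j"
proof -
  have diag: "expectation (W k i i) = M1 n a p i"
    using expectation_active[OF i] by (simp add: W_diag[OF i] cong: Bochner_Integration.integral_cong)
  define c where "c = p i * binomial_mean (p i) (card (nbrs i) - 1) (\<lambda>m. 1 / (real m + 2))"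
  have off: "expectation (W k i j) = a j i * c" if "j < n" "j \<noteq> i" for j
  proof (cases "j \<in> nbrs i")
    case True
    then show ?thesis using expectation_W_off_eq[OF i True] that i by (simp add: c_def a_nbrs)
  next
    case False
    then have "W k i j = (\<lambda>_. 0)" using that i by (auto simp: W_off)
    then show ?thesis using False that i by (simp add: a_nbrs)
  qed
  have "1 = expectation (\<lambda>\<omega>. \<Sum>j<n. W k i j \<omega>)"
    by (simp add: W_row_sum[OF i] prob_space)
  also have "\<dots> = (\<Sum>j<n. expectation (W k i j))"
    using W_integrable i by (intro Bochner_Integration.integral_sum) auto
  also have "\<dots> = (\<Sum>j<n. (if j = i then M1 n a p i else 0) + a j i * c)"
    by (intro sum.cong refl) (use diag off a_diag i in auto)
  also have "\<dots> = M1 n a p i + deg n a i * c"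
    using i by (simp add: sum.distrib sum_distrib_right[symmetric] deg_def)
  finally have "c = (1 - M1 n a p i) / deg n a i"
    using degpos[OF i] by (simp add: field_simps)
  then show ?thesis using diag off[OF j] a_diag[OF i] by (auto simp: P_def)
qed

lemma P_row_sum: "i < n \<Longrightarrow> (\<Sum>j<n. P i j) = 1"
  using degpos[of i]
  by (simp add: P_def sum.distrib sum_divide_distrib[symmetric] sum_distrib_left[symmetric] deg_def[symmetric])

lemma P_row_sq: assumes i: "i < n"
  shows "(\<Sum>j<n. (P i j)^2) = (M1 n a p i)^2 + (1 - M1 n a p i)^2 / deg n a i"
proof -
  have "(\<Sum>j<n. (P i j)^2) = (\<Sum>j<n. (if j = i then (M1 n a p i)^2 else 0) + a j i * ((1 - M1 n a p i)^2 / (deg n a i)^2))"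
  proof (intro sum.cong refl)
    fix j assume "j \<in> {..<n}"
    then show "(P i j)^2 = (if j = i then (M1 n a p i)^2 else 0) + a j i * ((1 - M1 n a p i)^2 / (deg n a i)^2)"
      using a01[of j i] a_diag[OF i] i by (auto simp: P_def power_divide)
  qed
  also have "\<dots> = (M1 n a p i)^2 + deg n a i * ((1 - M1 n a p i)^2 / (deg n a i)^2)"
    using i by (simp only: sum.distrib sum_distrib_right[symmetric] deg_def[symmetric]) simp
  finally show ?thesis using degpos[OF i] by (simp add: power2_eq_square)
qed

text \<open>The mean of the sum of squared entries is \<open>M1\<close> by \<open>W_row_sq\<close>,
  and subtracting the squared means leaves \<open>(1 - M1) * (M1 - (1 - M1) / deg)\<close>.\<close>

lemma W_variance_sum: assumes i: "i < n"
  shows "(\<Sum>j<n. expectation (\<lambda>\<omega>. (W k i j \<omega> - P i j)^2)) = Sfac n a p i / 2"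
proof -
  have int2: "integrable M (\<lambda>\<omega>. (W k i j \<omega>)^2)" if "j < n" for j
    by (rule integrable_det[OF _ row_sub determined_by_comp[OF W_det, where f = "\<lambda>x. x^2"]]) (use that i in auto)
  have "expectation (\<lambda>\<omega>. (W k i j \<omega> - P i j)^2) = expectation (\<lambda>\<omega>. (W k i j \<omega>)^2) - (P i j)^2" if "j < n" for j
  proof -
    have "expectation (\<lambda>\<omega>. (W k i j \<omega> - P i j)^2) = expectation (\<lambda>\<omega>. (W k i j \<omega>)^2 - 2 * P i j * W k i j \<omega> + (P i j)^2)"
      by (simp add: power2_eq_square algebra_simps)
    also have "\<dots> = expectation (\<lambda>\<omega>. (W k i j \<omega>)^2) - 2 * P i j * P i j + (P i j)^2"
      using int2[OF that] W_integrable[OF i that, of k] by (simp add: expectation_W i that prob_space)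
    finally show ?thesis by (simp add: power2_eq_square)
  qed
  then have "(\<Sum>j<n. expectation (\<lambda>\<omega>. (W k i j \<omega> - P i j)^2))
      = (\<Sum>j<n. expectation (\<lambda>\<omega>. (W k i j \<omega>)^2)) - (\<Sum>j<n. (P i j)^2)"
    by (simp add: sum_subtractf)
  also have "(\<Sum>j<n. expectation (\<lambda>\<omega>. (W k i j \<omega>)^2)) = M1 n a p i"
    using int2 by (subst Bochner_Integration.integral_sum[symmetric]) (auto simp: W_row_sq i expectation_active)
  finally show ?thesis
    unfolding P_row_sq[OF i] Sfac_def using degpos[OF i] by (simp add: power2_eq_square field_simps)
qed

text \<open>Both bounds come from the probabilistic meaning instead of the closed formula:
  \<open>M1\<close> is the mean of a diagonal entry that is at least \<open>1/n\<close>, and a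
  neighbour's entry in the same row has positive mean.\<close>

lemma M1_bounds: assumes i: "i < n" shows "1 / real n \<le> M1 n a p i" "M1 n a p i < 1"
proof -
  have "expectation (\<lambda>_. 1 / real n) \<le> expectation (W 0 i i)"
    using W_integrable[OF i i, of 0] W_diag_ge[OF i] by (intro integral_mono) auto
  then show "1 / real n \<le> M1 n a p i"
    by (simp add: expectation_W i P_def a_diag prob_space)
  obtain j where j: "j \<in> nbrs i" using card_nbrs[OF i] by fastforce
  have jn: "j < n" "j \<noteq> i" using j nbrs i by auto
  have "0 < expectation (W 0 i j)"
    unfolding expectation_W_off_eq[OF i j] using p01[OF i]
    by (intro mult_pos_pos binomial_mean_positive) auto
  then show "M1 n a p i < 1"
    using jn j i degpos[OF i] by (simp add: expectation_W P_def a_nbrs zero_less_divide_iff)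
qed

end

text \<open>A quantitative Jensen inequality. After centring at \<open>y i\<close> the term of index
  \<open>i\<close> drops out of the weighted mean, so Cauchy-Schwarz only sees the remaining mass
  \<open>1 - v i\<close>, which is at most \<open>1 - r\<close>.\<close>

lemma stochastic_row_contraction:
  fixes v y :: "nat \<Rightarrow> real"
  assumes v0: "\<And>j. j < n \<Longrightarrow> 0 \<le> v j" and v1: "(\<Sum>j<n. v j) = 1" and i: "i < n" and r: "r \<le> v i"
  shows "(\<Sum>j<n. v j * y j)^2 \<le> (\<Sum>j<n. v j * (y j)^2) - r * (\<Sum>j<n. v j * (y j - y i)^2)"
proof -
  define z where "z j = y j - y i" for j
  \<comment> \<open>Erasing the weight at \<open>i\<close> changes no centred sum, since
    \<open>z i = 0\<close>, but lowers the total mass to \<open>1 - v i\<close>.\<close>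
  define u where "u j = (if j = i then 0 else v j)" for j
  define m where "m = (\<Sum>j<n. v j * z j)"
  define q where "q = (\<Sum>j<n. v j * (z j)^2)"
  have zi: "z i = 0" by (simp add: z_def)
  have q0: "0 \<le> q" unfolding q_def using v0 by (intro sum_nonneg) auto
  have uv: "u j = v j - (if j = i then v i else 0)" for j by (auto simp: u_def)
  have "(\<Sum>j<n. u j) = 1 - v i" using i v1 by (simp add: uv sum_subtractf)
  moreover have "m = (\<Sum>j<n. sqrt (u j) * (sqrt (u j) * z j))"
    unfolding m_def using v0 zi by (intro sum.cong) (auto simp: u_def simp flip: mult.assoc)
  moreover have "q = (\<Sum>j<n. (sqrt (u j) * z j)^2)"
    unfolding q_def using v0 zi by (intro sum.cong) (auto simp: u_def power_mult_distrib)
  moreover have "(\<Sum>j<n. u j) = (\<Sum>j<n. (sqrt (u j))^2)"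
    using v0 by (intro sum.cong) (auto simp: u_def)
  ultimately have "m^2 \<le> (1 - v i) * q"
    using Cauchy_Schwarz_ineq_sum[of "\<lambda>j. sqrt (u j)" "\<lambda>j. sqrt (u j) * z j" "{..<n}"] by simp
  also have "\<dots> \<le> (1 - r) * q" using r q0 by (intro mult_right_mono) auto
  finally have mq: "m^2 \<le> (1 - r) * q" .
  have y: "y j = y i + z j" for j by (simp add: z_def)
  have "(\<Sum>j<n. v j * y j) = (\<Sum>j<n. v j * y i + v j * z j)"
    by (intro sum.cong refl) (simp add: z_def algebra_simps)
  then have s1: "(\<Sum>j<n. v j * y j) = y i + m"
    by (simp add: sum.distrib m_def sum_distrib_right[symmetric] v1)
  have "(\<Sum>j<n. v j * (y j)^2) = (\<Sum>j<n. v j * (y i)^2 + 2 * y i * (v j * z j) + v j * (z j)^2)"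
    by (intro sum.cong refl) (simp add: z_def power2_eq_square algebra_simps)
  then have s2: "(\<Sum>j<n. v j * (y j)^2) = (y i)^2 + 2 * y i * m + q"
    by (simp add: sum.distrib m_def q_def sum_distrib_right[symmetric] sum_distrib_left[symmetric] v1)
  have s3: "(\<Sum>j<n. v j * (y j - y i)^2) = q" by (simp add: q_def z_def)
  show ?thesis unfolding s1 s2 s3 using mq by (simp add: power2_eq_square algebra_simps)
qed

section \<open>Reversing weights, dissipation of the weighted energy, and summability of the edge
  energy\<close>

context gossip
begin

definition Z :: real where "Z = (\<Sum>i<n. deg n a i / (1 - M1 n a p i))"
definition w :: "nat \<Rightarrow> real" where "w i = deg n a i / (1 - M1 n a p i) / Z"

lemma weight_pos: "i < n \<Longrightarrow> 0 < deg n a i / (1 - M1 n a p i)"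
  using degpos[of i] M1_bounds(2)[of i] by simp

lemma Z_pos: "0 < Z"
  unfolding Z_def using n2 weight_pos by (intro sum_pos) (auto simp: lessThan_empty_iff)

lemma w_pos: "i < n \<Longrightarrow> 0 < w i"
  unfolding w_def by (rule divide_pos_pos[OF weight_pos Z_pos])

lemma w_sum: "(\<Sum>i<n. w i) = 1"
  unfolding w_def sum_divide_distrib[symmetric] Z_def[symmetric] using Z_pos by simp

lemma w_P: assumes "i < n" "j < n" "i \<noteq> j" shows "w i * P i j = a i j / Z"
proof -
  have "deg n a i > 0" "1 - M1 n a p i > 0" using degpos[OF assms(1)] M1_bounds(2)[OF assms(1)] by auto
  then show ?thesis using assms Z_pos by (simp add: w_def P_def a_sym[of j i])
qed

lemma w_rev: "i < n \<Longrightarrow> j < n \<Longrightarrow> w i * P i j = w j * P j i"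
  by (cases "i = j") (simp_all add: w_P a_sym[of i j])

lemmas w_P_col = reversible_stationary[OF w_rev P_row_sum]

definition G :: "nat \<Rightarrow> real" where
  "G k = (\<Sum>i<n. \<Sum>j<n. a i j * expectation (\<lambda>\<omega>. (x k j \<omega> - x k i \<omega>)^2))"

lemma past_integrable: "determined_by coin (past k) F \<Longrightarrow> integrable M F"
  by (rule integrable_det[OF past_finite past_sub])

lemma diff_det: "i < n \<Longrightarrow> j < n \<Longrightarrow> determined_by coin (past k) (\<lambda>\<omega>. (x k j \<omega> - x k i \<omega>)^2)"
  by (rule determined_by_comp2[OF x_det x_det])

lemma G_nonneg: "0 \<le> G k"
  unfolding G_def using a01 by (intro sum_nonneg mult_nonneg_nonneg) (auto, force)

lemma G_edge: assumes "i < n" "j < n" "a i j \<noteq> 0"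
  shows "expectation (\<lambda>\<omega>. (x k j \<omega> - x k i \<omega>)^2) \<le> G k"
proof -
  let ?e = "\<lambda>i j. a i j * expectation (\<lambda>\<omega>. (x k j \<omega> - x k i \<omega>)^2)"
  have nn: "0 \<le> ?e i j" if "i < n" "j < n" for i j
    using a01[OF that] by auto
  have "?e i j \<le> (\<Sum>j<n. ?e i j)" using assms nn by (intro member_le_sum) auto
  also have "\<dots> \<le> G k" unfolding G_def using assms nn
    by (intro member_le_sum[of i "{..<n}" "\<lambda>i. \<Sum>j<n. ?e i j"] sum_nonneg) auto
  finally show ?thesis using assms a01[of i j] by simp
qed

lemma row_past: "row (Suc k) i \<inter> past k = {}"
  by (auto simp: row_def past_def)

lemma W_past: assumes "i < n" "j < n" and F: "determined_by coin (past k) F"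
  shows "expectation (\<lambda>\<omega>. W (Suc k) i j \<omega> * F \<omega>) = P i j * expectation F"
    and "integrable M (\<lambda>\<omega>. W (Suc k) i j \<omega> * F \<omega>)"
proof -
  show "expectation (\<lambda>\<omega>. W (Suc k) i j \<omega> * F \<omega>) = P i j * expectation F"
    using mult_det[OF row_finite past_finite row_sub[OF assms(1)] past_sub row_past W_det[OF assms(1,2)] F] assms
    by (simp add: expectation_W)
  show "integrable M (\<lambda>\<omega>. W (Suc k) i j \<omega> * F \<omega>)"
  proof (rule integrable_det)
    show "determined_by coin (past (Suc k)) (\<lambda>\<omega>. W (Suc k) i j \<omega> * F \<omega>)"
      using assms by (intro determined_by_comp2[of _ _ _ _ "(*)"] determined_by_mono[OF W_det] determined_by_mono[OF F])
        (auto simp: row_def past_def)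
  qed (rule past_finite past_sub)+
qed

definition Q :: "real \<Rightarrow> nat \<Rightarrow> real" where
  "Q c k = (\<Sum>i<n. w i * expectation (\<lambda>\<omega>. (x k i \<omega> - c)^2))"

text \<open>The contraction of each row is averaged, using that fresh coins are independent of the
  past. Stationarity turns the averaged main term back into \<open>Q c k\<close>, and the loss term
  is the edge energy up to scaling.\<close>

lemma Q_decrease: "Q c (Suc k) + G k / (real n * Z) \<le> Q c k"
proof -
  let ?q = "\<lambda>j \<omega>. (x k j \<omega> - c)^2" and ?d = "\<lambda>i j \<omega>. (x k j \<omega> - x k i \<omega>)^2"
  have qdet: "determined_by coin (past k) (?q j)" if "j < n" for j
    by (rule determined_by_comp[OF x_det[OF that]])
  have step: "expectation (\<lambda>\<omega>. (x (Suc k) i \<omega> - c)^2)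
     \<le> (\<Sum>j<n. P i j * expectation (?q j)) - 1 / real n * (\<Sum>j<n. P i j * expectation (?d i j))"
    if i: "i < n" for i
  proof -
    have "(x (Suc k) i \<omega> - c)^2 \<le> (\<Sum>j<n. W (Suc k) i j \<omega> * ?q j \<omega>) - 1 / real n * (\<Sum>j<n. W (Suc k) i j \<omega> * ?d i j \<omega>)" for \<omega>
    proof -
      have "x (Suc k) i \<omega> - c = (\<Sum>j<n. W (Suc k) i j \<omega> * (x k j \<omega> - c))"
        using W_row_sum[OF i, of "Suc k" \<omega>]
        by (simp add: x_Suc[OF i] right_diff_distrib sum_subtractf sum_distrib_right[symmetric] del: xdyn.simps)
      then show ?thesis
        using stochastic_row_contraction[OF W_nonneg[OF i] W_row_sum[OF i] i W_diag_ge[OF i], where y = "\<lambda>j. x k j \<omega> - c"]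
        by simp
    qed
    then have "expectation (\<lambda>\<omega>. (x (Suc k) i \<omega> - c)^2)
       \<le> expectation (\<lambda>\<omega>. (\<Sum>j<n. W (Suc k) i j \<omega> * ?q j \<omega>) - 1 / real n * (\<Sum>j<n. W (Suc k) i j \<omega> * ?d i j \<omega>))"
      using i qdet diff_det
      by (intro integral_mono past_integrable[OF determined_by_comp[OF x_det]] Bochner_Integration.integrable_diff
          Bochner_Integration.integrable_sum integrable_mult_right W_past(2)) auto
    also have "\<dots> = (\<Sum>j<n. P i j * expectation (?q j)) - 1 / real n * (\<Sum>j<n. P i j * expectation (?d i j))"
      using i W_past[OF i _ qdet] W_past[OF i _ diff_det[OF i]]
      by (subst Bochner_Integration.integral_diff)
        (auto simp: Bochner_Integration.integral_sum intro!: Bochner_Integration.integrable_sum integrable_mult_right)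
    finally show ?thesis .
  qed
  have "Q c (Suc k) \<le> (\<Sum>i<n. w i * ((\<Sum>j<n. P i j * expectation (?q j)) - 1 / real n * (\<Sum>j<n. P i j * expectation (?d i j))))"
    unfolding Q_def using step w_pos by (intro sum_mono mult_left_mono) (auto simp: less_imp_le simp del: xdyn.simps)
  also have "\<dots> = (\<Sum>i<n. \<Sum>j<n. w i * P i j * expectation (?q j)) - 1 / real n * (\<Sum>i<n. \<Sum>j<n. w i * P i j * expectation (?d i j))"
    by (simp add: right_diff_distrib sum_subtractf sum_distrib_left ac_simps)
  also have "(\<Sum>i<n. \<Sum>j<n. w i * P i j * expectation (?q j)) = Q c k"
    by (subst sum.swap) (simp add: sum_distrib_right[symmetric] w_P_col Q_def)
  \<comment> \<open>Off the diagonal every edge has the same conductance \<open>1 / Z\<close>;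
    diagonal terms vanish because their squared difference is 0.\<close>
  also have "(\<Sum>i<n. \<Sum>j<n. w i * P i j * expectation (?d i j)) = G k / Z"
    unfolding G_def sum_divide_distrib
  proof (intro sum.cong refl)
    fix i j assume "i \<in> {..<n}" "j \<in> {..<n}"
    then show "w i * P i j * expectation (?d i j) = a i j * expectation (?d i j) / Z"
      by (cases "i = j") (simp_all add: w_P)
  qed
  finally show ?thesis by simp
qed

lemma Q_nonneg: "0 \<le> Q c k"
  unfolding Q_def using w_pos by (intro sum_nonneg mult_nonneg_nonneg) (auto simp: less_imp_le)

lemma G_sum: "(\<Sum>k<T. G k) \<le> real n * Z * Q c 0"
proof -
  have nZ: "0 < real n * Z" using n2 Z_pos by simp
  have "Q c T + (\<Sum>k<T. G k) / (real n * Z) \<le> Q c 0"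
  proof (induction T)
    case (Suc T)
    then show ?case using Q_decrease[of c T] by (simp add: add_divide_distrib)
  qed simp
  then have "(\<Sum>k<T. G k) / (real n * Z) \<le> Q c 0" using Q_nonneg[of c T] by simp
  then show ?thesis using nZ by (simp add: pos_divide_le_eq mult.commute)
qed

section \<open>The weighted average as a martingale and the growth of its variance\<close>

definition y :: "nat \<Rightarrow> 'w \<Rightarrow> real" where
  "y k \<omega> = (\<Sum>i<n. w i * x k i \<omega>)"

lemma y_det: "determined_by coin (past k) (y k)"
  unfolding y_def[abs_def]
proof (rule determined_by_sum)
  fix j assume "j \<in> {..<n}"
  then show "determined_by coin (past k) (\<lambda>\<omega>. w j * x k j \<omega>)"
    using determined_by_comp[OF x_det, where f = "\<lambda>z. w j * z"] by simp
qed

definition V :: "nat \<Rightarrow> nat \<Rightarrow> nat \<Rightarrow> 'w \<Rightarrow> real" where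
  "V k i j \<omega> = W k i j \<omega> - P i j"

text \<open>The innovation at vertex \<open>i\<close>: its value at time \<open>k + 1\<close> minus
  the conditional mean given the coins up to time \<open>k\<close>.\<close>

definition \<eta> :: "nat \<Rightarrow> nat \<Rightarrow> 'w \<Rightarrow> real" where
  "\<eta> k i \<omega> = (\<Sum>j<n. V (Suc k) i j \<omega> * x k j \<omega>)"

lemma V_det: "i < n \<Longrightarrow> j < n \<Longrightarrow> determined_by coin (row k i) (V k i j)"
  unfolding V_def[abs_def] by (rule determined_by_comp[OF W_det])

lemma V_mean: "i < n \<Longrightarrow> j < n \<Longrightarrow> expectation (V k i j) = 0"
  using W_integrable by (simp add: V_def[abs_def] expectation_W prob_space)

lemma V_det_past: "i < n \<Longrightarrow> j < n \<Longrightarrow> determined_by coin (past (Suc k)) (V (Suc k) i j)"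
  by (rule determined_by_mono[OF V_det]) (auto simp: row_def past_def)

lemma past_Suc: "determined_by coin (past k) F \<Longrightarrow> determined_by coin (past (Suc k)) F"
  by (rule determined_by_mono) (auto simp: past_def)

lemma eta_det: "i < n \<Longrightarrow> determined_by coin (past (Suc k)) (\<eta> k i)"
  unfolding \<eta>_def[abs_def] by (intro determined_by_sum determined_by_comp2[of _ _ _ _ "(*)"] V_det_past past_Suc x_det) auto

text \<open>The set \<open>K\<close> may contain coins of other rows at the same time
  \<open>k + 1\<close>. This covers both uses: orthogonality to the past and orthogonality between
  different vertices.\<close>

lemma V_uncorrelated:
  assumes ij: "i < n" "j < n" and K: "K \<subseteq> past (Suc k) - row (Suc k) i" and F: "determined_by coin K F"
  shows "expectation (\<lambda>\<omega>. V (Suc k) i j \<omega> * F \<omega>) = 0"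
proof -
  have "K \<subseteq> UNIV \<times> {..<n} \<times> {..<n}" "finite K"
    using K past_sub[of "Suc k"] finite_subset[of K "past (Suc k)"] by auto
  then have "expectation (\<lambda>\<omega>. V (Suc k) i j \<omega> * F \<omega>) = expectation (V (Suc k) i j) * expectation F"
    using K ij by (intro mult_det[OF row_finite _ row_sub _ _ V_det F]) auto
  then show ?thesis using V_mean[OF ij] by simp
qed

lemma eta_past: assumes i: "i < n" and F: "determined_by coin (past k) F"
  shows "expectation (\<lambda>\<omega>. F \<omega> * \<eta> k i \<omega>) = 0"
proof -
  have "expectation (\<lambda>\<omega>. F \<omega> * \<eta> k i \<omega>) = expectation (\<lambda>\<omega>. \<Sum>j<n. V (Suc k) i j \<omega> * (x k j \<omega> * F \<omega>))"
    by (simp add: \<eta>_def sum_distrib_left ac_simps)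
  also have "\<dots> = (\<Sum>j<n. expectation (\<lambda>\<omega>. V (Suc k) i j \<omega> * (x k j \<omega> * F \<omega>)))"
    by (intro Bochner_Integration.integral_sum past_integrable[of "Suc k"] determined_by_comp2[of _ _ _ _ "(*)"] V_det_past past_Suc x_det F i) auto
  also have "\<dots> = 0"
    by (intro sum.neutral ballI V_uncorrelated[of _ _ "past k"] determined_by_comp2[of _ _ _ _ "(*)"] x_det F i) (auto simp: past_def row_def)
  finally show ?thesis .
qed

lemma eta_uncorrelated: assumes i: "i < n" "i' < n" "i \<noteq> i'"
  shows "expectation (\<lambda>\<omega>. \<eta> k i \<omega> * \<eta> k i' \<omega>) = 0"
proof -
  define K where "K = past k \<union> row (Suc k) i'"
  have K: "K \<subseteq> past (Suc k) - row (Suc k) i" using i by (auto simp: K_def past_def row_def)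
  have det: "determined_by coin K (\<eta> k i')"
    unfolding \<eta>_def[abs_def] K_def using i
    by (intro determined_by_sum determined_by_comp2[of _ _ _ _ "(*)"] determined_by_mono[OF V_det] determined_by_mono[OF x_det]) auto
  have x_K: "determined_by coin K (x k j)" if "j < n" for j
    using x_det[OF that] by (rule determined_by_mono) (auto simp: K_def)
  have "expectation (\<lambda>\<omega>. \<eta> k i \<omega> * \<eta> k i' \<omega>) = expectation (\<lambda>\<omega>. \<Sum>j<n. V (Suc k) i j \<omega> * (x k j \<omega> * \<eta> k i' \<omega>))"
    unfolding \<eta>_def[of k i] sum_distrib_right by (simp add: mult.assoc)
  also have "\<dots> = (\<Sum>j<n. expectation (\<lambda>\<omega>. V (Suc k) i j \<omega> * (x k j \<omega> * \<eta> k i' \<omega>)))"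
    by (intro Bochner_Integration.integral_sum past_integrable[of "Suc k"] determined_by_comp2[of _ _ _ _ "(*)"] V_det_past past_Suc x_det eta_det i) auto
  also have "\<dots> = 0"
    by (intro sum.neutral ballI V_uncorrelated[OF _ _ K] determined_by_comp2[of _ _ _ _ "(*)"] x_K det i) auto
  finally show ?thesis .
qed

text \<open>Rows of \<open>V\<close> sum to 0, so \<open>x k i\<close> may be subtracted, and only
  neighbours then contribute. Cauchy-Schwarz separates the noise from the differences, and
  independence factors the expectation.\<close>

lemma eta_sq: assumes i: "i < n"
  shows "expectation (\<lambda>\<omega>. (\<eta> k i \<omega>)^2) \<le> Sfac n a p i / 2 * (\<Sum>j<n. a i j * expectation (\<lambda>\<omega>. (x k j \<omega> - x k i \<omega>)^2))"
proof -
  let ?v = "\<lambda>j \<omega>. (V (Suc k) i j \<omega>)^2" and ?d = "\<lambda>l \<omega>. (x k l \<omega> - x k i \<omega>)^2"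
  have pt: "(\<eta> k i \<omega>)^2 \<le> (\<Sum>j<n. \<Sum>l<n. a i l * (?v j \<omega> * ?d l \<omega>))" for \<omega>
  proof -
    have "(\<Sum>j<n. V (Suc k) i j \<omega>) = 0"
      by (simp add: V_def sum_subtractf W_row_sum i P_row_sum)
    then have "\<eta> k i \<omega> = (\<Sum>j<n. V (Suc k) i j \<omega> * (x k j \<omega> - x k i \<omega>))"
      by (simp add: \<eta>_def right_diff_distrib sum_subtractf sum_distrib_right[symmetric])
    \<comment> \<open>The factor \<open>a i j\<close> can be inserted for free: at
      \<open>j = i\<close> the difference is 0, and at other non-neighbours \<open>V\<close> is
      0.\<close>
    also have "\<dots> = (\<Sum>j<n. V (Suc k) i j \<omega> * (a i j * (x k j \<omega> - x k i \<omega>)))"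
    proof (intro sum.cong refl)
      fix j assume "j \<in> {..<n}"
      then have j: "j < n" by simp
      show "V (Suc k) i j \<omega> * (x k j \<omega> - x k i \<omega>) = V (Suc k) i j \<omega> * (a i j * (x k j \<omega> - x k i \<omega>))"
        using a01[OF i j] a_sym[OF i j] i j by (auto simp: V_def W_def atil_def P_def)
    qed
    finally have "(\<eta> k i \<omega>)^2 \<le> (\<Sum>j<n. ?v j \<omega>) * (\<Sum>l<n. (a i l * (x k l \<omega> - x k i \<omega>))^2)"
      using Cauchy_Schwarz_ineq_sum by metis
    also have "(\<Sum>l<n. (a i l * (x k l \<omega> - x k i \<omega>))^2) = (\<Sum>l<n. a i l * ?d l \<omega>)"
      using a01[OF i] by (intro sum.cong) (force simp: power_mult_distrib)+
    finally show ?thesis by (simp add: sum_product ac_simps)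
  qed
  have vdet: "determined_by coin (row (Suc k) i) (?v j)" if "j < n" for j
    using V_det[OF i that] by (rule determined_by_comp)
  have int: "integrable M (\<lambda>\<omega>. a i l * (?v j \<omega> * ?d l \<omega>))" if "j < n" "l < n" for j l
    by (intro integrable_mult_right past_integrable[of "Suc k"] determined_by_comp2[of _ _ _ _ "(*)"] determined_by_comp[OF V_det_past] past_Suc diff_det i that)
  have "expectation (\<lambda>\<omega>. (\<eta> k i \<omega>)^2) \<le> expectation (\<lambda>\<omega>. \<Sum>j<n. \<Sum>l<n. a i l * (?v j \<omega> * ?d l \<omega>))"
    using pt int by (intro integral_mono past_integrable[OF determined_by_comp[OF eta_det[OF i]]] Bochner_Integration.integrable_sum) auto
  also have "\<dots> = (\<Sum>j<n. expectation (\<lambda>\<omega>. \<Sum>l<n. a i l * (?v j \<omega> * ?d l \<omega>)))"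
    by (intro Bochner_Integration.integral_sum Bochner_Integration.integrable_sum int) auto
  also have "\<dots> = (\<Sum>j<n. \<Sum>l<n. expectation (\<lambda>\<omega>. a i l * (?v j \<omega> * ?d l \<omega>)))"
    by (intro sum.cong refl Bochner_Integration.integral_sum int) auto
  also have "\<dots> = (\<Sum>j<n. \<Sum>l<n. a i l * expectation (\<lambda>\<omega>. ?v j \<omega> * ?d l \<omega>))"
    by simp
  also have "\<dots> = (\<Sum>j<n. \<Sum>l<n. a i l * (expectation (?v j) * expectation (?d l)))"
  proof (intro sum.cong refl arg_cong2[of _ _ _ _ "(*)"])
    fix j l assume "j \<in> {..<n}" "l \<in> {..<n}"
    then show "expectation (\<lambda>\<omega>. ?v j \<omega> * ?d l \<omega>) = expectation (?v j) * expectation (?d l)"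
      using i by (intro mult_det[OF row_finite past_finite row_sub past_sub _ vdet diff_det]) (auto simp: row_def past_def)
  qed
  also have "\<dots> = (\<Sum>j<n. expectation (?v j)) * (\<Sum>l<n. a i l * expectation (?d l))"
    by (simp add: sum_product ac_simps)
  also have "(\<Sum>j<n. expectation (?v j)) = Sfac n a p i / 2"
    using W_variance_sum[OF i, of "Suc k"] by (simp add: V_def)
  finally show ?thesis .
qed

lemma y_step: "y (Suc k) \<omega> = y k \<omega> + (\<Sum>i<n. w i * \<eta> k i \<omega>)"
proof -
  have "(\<Sum>i<n. w i * x (Suc k) i \<omega>) = (\<Sum>i<n. w i * \<eta> k i \<omega> + (\<Sum>j<n. w i * P i j * x k j \<omega>))"
    by (intro sum.cong refl)
      (simp add: x_Suc \<eta>_def V_def left_diff_distrib sum_subtractf sum_distrib_left right_diff_distrib ac_simps del: xdyn.simps)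
  also have "\<dots> = (\<Sum>i<n. w i * \<eta> k i \<omega>) + (\<Sum>i<n. \<Sum>j<n. w i * P i j * x k j \<omega>)"
    by (simp add: sum.distrib)
  also have "(\<Sum>i<n. \<Sum>j<n. w i * P i j * x k j \<omega>) = y k \<omega>"
    by (subst sum.swap) (simp add: sum_distrib_right[symmetric] w_P_col y_def)
  finally show ?thesis by (simp add: y_def)
qed

text \<open>Among the terms of the expanded square, those mixing past and innovation have mean 0, as
  do products of innovations at different vertices. Only the squares of the innovations
  remain.\<close>

lemma y_variance_step:
  assumes wm: "\<And>i. i < n \<Longrightarrow> w i \<le> wm" and Sm: "\<And>i. i < n \<Longrightarrow> Sfac n a p i \<le> Sm"
  shows "expectation (\<lambda>\<omega>. (y (Suc k) \<omega> - c)^2) \<le> expectation (\<lambda>\<omega>. (y k \<omega> - c)^2) + wm^2 * (Sm / 2) * G k"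
proof -
  have exp: "(y (Suc k) \<omega> - c)^2 = (y k \<omega> - c)^2 + (\<Sum>i<n. 2 * w i * ((y k \<omega> - c) * \<eta> k i \<omega>))
      + (\<Sum>i<n. \<Sum>i'<n. w i * w i' * (\<eta> k i \<omega> * \<eta> k i' \<omega>))" for \<omega>
  proof -
    have "(y (Suc k) \<omega> - c)^2 = (y k \<omega> - c)^2 + 2 * (y k \<omega> - c) * (\<Sum>i<n. w i * \<eta> k i \<omega>) + (\<Sum>i<n. w i * \<eta> k i \<omega>) * (\<Sum>i<n. w i * \<eta> k i \<omega>)"
      unfolding y_step by (simp add: power2_eq_square algebra_simps)
    moreover have "2 * (y k \<omega> - c) * (\<Sum>i<n. w i * \<eta> k i \<omega>) = (\<Sum>i<n. 2 * w i * ((y k \<omega> - c) * \<eta> k i \<omega>))"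
      unfolding sum_distrib_left by (intro sum.cong refl) (simp add: algebra_simps)
    moreover have "(\<Sum>i<n. w i * \<eta> k i \<omega>) * (\<Sum>i<n. w i * \<eta> k i \<omega>) = (\<Sum>i<n. \<Sum>i'<n. w i * w i' * (\<eta> k i \<omega> * \<eta> k i' \<omega>))"
      unfolding sum_product by (intro sum.cong refl) (simp add: algebra_simps)
    ultimately show ?thesis by simp
  qed
  have yc: "determined_by coin (past k) (\<lambda>\<omega>. y k \<omega> - c)" by (rule determined_by_comp[OF y_det])
  have i1: "integrable M (\<lambda>\<omega>. (y k \<omega> - c)^2)" by (rule past_integrable[OF determined_by_comp[OF y_det]])
  have i2: "integrable M (\<lambda>\<omega>. 2 * w i * ((y k \<omega> - c) * \<eta> k i \<omega>))" if "i < n" for i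
    by (intro integrable_mult_right past_integrable[of "Suc k"] determined_by_comp2[of _ _ _ _ "(*)"] past_Suc[OF yc] eta_det that)
  have i3: "integrable M (\<lambda>\<omega>. w i * w i' * (\<eta> k i \<omega> * \<eta> k i' \<omega>))" if "i < n" "i' < n" for i i'
    by (intro integrable_mult_right past_integrable[of "Suc k"] determined_by_comp2[of _ _ _ _ "(*)"] eta_det that)
  have expand: "expectation (\<lambda>\<omega>. (y (Suc k) \<omega> - c)^2) = expectation (\<lambda>\<omega>. (y k \<omega> - c)^2)
      + (\<Sum>i<n. 2 * w i * expectation (\<lambda>\<omega>. (y k \<omega> - c) * \<eta> k i \<omega>))
      + (\<Sum>i<n. \<Sum>i'<n. w i * w i' * expectation (\<lambda>\<omega>. \<eta> k i \<omega> * \<eta> k i' \<omega>))"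
  proof -
    have s2: "integrable M (\<lambda>\<omega>. \<Sum>i<n. 2 * w i * ((y k \<omega> - c) * \<eta> k i \<omega>))"
      by (intro Bochner_Integration.integrable_sum i2) auto
    have s3: "integrable M (\<lambda>\<omega>. \<Sum>i<n. \<Sum>i'<n. w i * w i' * (\<eta> k i \<omega> * \<eta> k i' \<omega>))"
      by (intro Bochner_Integration.integrable_sum i3) auto
    have e2: "expectation (\<lambda>\<omega>. \<Sum>i<n. 2 * w i * ((y k \<omega> - c) * \<eta> k i \<omega>))
        = (\<Sum>i<n. expectation (\<lambda>\<omega>. 2 * w i * ((y k \<omega> - c) * \<eta> k i \<omega>)))"
      by (intro Bochner_Integration.integral_sum i2) auto
    have "expectation (\<lambda>\<omega>. \<Sum>i<n. \<Sum>i'<n. w i * w i' * (\<eta> k i \<omega> * \<eta> k i' \<omega>))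
        = (\<Sum>i<n. expectation (\<lambda>\<omega>. \<Sum>i'<n. w i * w i' * (\<eta> k i \<omega> * \<eta> k i' \<omega>)))"
      by (intro Bochner_Integration.integral_sum Bochner_Integration.integrable_sum i3) auto
    also have "\<dots> = (\<Sum>i<n. \<Sum>i'<n. expectation (\<lambda>\<omega>. w i * w i' * (\<eta> k i \<omega> * \<eta> k i' \<omega>)))"
      by (intro sum.cong refl Bochner_Integration.integral_sum i3) auto
    finally have e3: "expectation (\<lambda>\<omega>. \<Sum>i<n. \<Sum>i'<n. w i * w i' * (\<eta> k i \<omega> * \<eta> k i' \<omega>))
        = (\<Sum>i<n. \<Sum>i'<n. expectation (\<lambda>\<omega>. w i * w i' * (\<eta> k i \<omega> * \<eta> k i' \<omega>)))" .
    show ?thesis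
      unfolding exp Bochner_Integration.integral_add[OF Bochner_Integration.integrable_add[OF i1 s2] s3]
        Bochner_Integration.integral_add[OF i1 s2] e2 e3 by simp
  qed
  have cross: "(\<Sum>i<n. 2 * w i * expectation (\<lambda>\<omega>. (y k \<omega> - c) * \<eta> k i \<omega>)) = 0"
    by (simp add: eta_past[OF _ yc])
  have "(\<Sum>i<n. \<Sum>i'<n. w i * w i' * expectation (\<lambda>\<omega>. \<eta> k i \<omega> * \<eta> k i' \<omega>))
      = (\<Sum>i<n. (w i)^2 * expectation (\<lambda>\<omega>. (\<eta> k i \<omega>)^2))"
  proof (intro sum.cong refl)
    fix i assume "i \<in> {..<n}"
    then have i: "i < n" by simp
    have "(\<Sum>i'<n. w i * w i' * expectation (\<lambda>\<omega>. \<eta> k i \<omega> * \<eta> k i' \<omega>))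
      = (\<Sum>i'<n. if i' = i then (w i)^2 * expectation (\<lambda>\<omega>. (\<eta> k i \<omega>)^2) else 0)"
      using i by (intro sum.cong refl) (auto simp: eta_uncorrelated power2_eq_square)
    then show "(\<Sum>i'<n. w i * w i' * expectation (\<lambda>\<omega>. \<eta> k i \<omega> * \<eta> k i' \<omega>)) = (w i)^2 * expectation (\<lambda>\<omega>. (\<eta> k i \<omega>)^2)"
      using i by simp
  qed
  also have "\<dots> \<le> (\<Sum>i<n. wm^2 * (Sm / 2 * (\<Sum>j<n. a i j * expectation (\<lambda>\<omega>. (x k j \<omega> - x k i \<omega>)^2))))"
  proof (intro sum_mono mult_mono)
    fix i assume "i \<in> {..<n}"
    then have i: "i < n" by simp
    show "(w i)^2 \<le> wm^2" using wm[OF i] w_pos[OF i] by (intro power_mono) auto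
    have nn: "0 \<le> (\<Sum>j<n. a i j * expectation (\<lambda>\<omega>. (x k j \<omega> - x k i \<omega>)^2))"
      using a01[OF i] by (intro sum_nonneg mult_nonneg_nonneg) (auto, force)
    show "expectation (\<lambda>\<omega>. (\<eta> k i \<omega>)^2) \<le> Sm / 2 * (\<Sum>j<n. a i j * expectation (\<lambda>\<omega>. (x k j \<omega> - x k i \<omega>)^2))"
      using eta_sq[OF i, of k] mult_right_mono[OF Sm[OF i] nn] by simp
  qed auto
  also have "\<dots> = wm^2 * (Sm / 2) * G k"
    unfolding G_def by (simp only: sum_distrib_left[symmetric] mult.assoc)
  finally show ?thesis unfolding expand cross by simp
qed

lemma y_variance:
  assumes wm: "\<And>i. i < n \<Longrightarrow> w i \<le> wm" and Sm: "\<And>i. i < n \<Longrightarrow> Sfac n a p i \<le> Sm"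
  shows "expectation (\<lambda>\<omega>. (y T \<omega> - (\<Sum>i<n. w i * x0 i))^2) \<le> wm^2 * (Sm / 2) * (\<Sum>k<T. G k)"
proof (induction T)
  case 0
  then show ?case by (simp add: y_def)
next
  case (Suc T)
  then show ?case
    using y_variance_step[OF wm Sm, of T "\<Sum>i<n. w i * x0 i"] by (simp add: distrib_left)
qed

lemma Sfac_nonneg: assumes i: "i < n" shows "0 \<le> Sfac n a p i"
proof -
  have "0 \<le> (\<Sum>j<n. expectation (\<lambda>\<omega>. (W 0 i j \<omega> - P i j)^2))" by (intro sum_nonneg) auto
  then show ?thesis using W_variance_sum[OF i] by simp
qed

text \<open>Centring at \<open>x0 k\<close> removes the term of vertex \<open>k\<close>, which
  leaves weight \<open>1 - w k\<close>. Each remaining difference is at most the sum of two distinct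
  absolute values, hence at most the 1-norm of \<open>x0\<close>, whose square is the norm of the
  Kronecker product.\<close>

lemma Q_0_le: assumes k: "k < n"
  shows "Q (x0 k) 0 \<le> (1 - w k) * (\<Sum>i<n. \<Sum>j<n. \<bar>x0 i * x0 j\<bar>)"
proof -
  let ?N = "\<Sum>i<n. \<bar>x0 i\<bar>"
  have N: "(\<Sum>i<n. \<Sum>j<n. \<bar>x0 i * x0 j\<bar>) = ?N^2"
    by (simp add: power2_eq_square sum_product abs_mult)
  have b: "(x0 i - x0 k)^2 \<le> ?N^2" if i: "i < n" for i
  proof (cases "i = k")
    case False
    have "\<bar>x0 i - x0 k\<bar> \<le> (\<Sum>j\<in>{i,k}. \<bar>x0 j\<bar>)" using False by simp
    also have "\<dots> \<le> ?N" using i k by (intro sum_mono2) auto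
    finally show ?thesis using abs_le_square_iff[of "x0 i - x0 k" ?N] by simp
  qed simp
  have "Q (x0 k) 0 = (\<Sum>i<n. w i * (x0 i - x0 k)^2)"
    by (simp add: Q_def prob_space)
  also have "\<dots> \<le> (\<Sum>i<n. if i = k then 0 else w i * ?N^2)"
    using b w_pos by (intro sum_mono) (auto intro!: mult_left_mono simp: less_imp_le)
  also have "\<dots> = (\<Sum>i<n. w i * ?N^2 - (if i = k then w k * ?N^2 else 0))"
    by (intro sum.cong) auto
  also have "\<dots> = (1 - w k) * ?N^2"
    using k w_sum by (simp add: sum_subtractf sum_distrib_right[symmetric] left_diff_distrib)
  finally show ?thesis by (simp add: N)
qed

section \<open>Boundedness, almost sure consensus, and passage to the limit\<close>

lemma x_between:
  assumes "\<And>j. j < n \<Longrightarrow> l \<le> x k j \<omega> \<and> x k j \<omega> \<le> u" "i < n"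
  shows "l \<le> x (Suc k) i \<omega> \<and> x (Suc k) i \<omega> \<le> u"
proof -
  have "(\<Sum>j<n. W (Suc k) i j \<omega> * l) \<le> (\<Sum>j<n. W (Suc k) i j \<omega> * x k j \<omega>)"
    "(\<Sum>j<n. W (Suc k) i j \<omega> * x k j \<omega>) \<le> (\<Sum>j<n. W (Suc k) i j \<omega> * u)"
    using assms W_nonneg by (auto intro!: sum_mono mult_left_mono)
  then show ?thesis
    using W_row_sum[OF assms(2)] by (simp add: x_Suc[OF assms(2)] sum_distrib_right[symmetric] del: xdyn.simps)
qed

definition C :: real where "C = (\<Sum>i<n. \<bar>x0 i\<bar>)"

lemma x_bounded: "i < n \<Longrightarrow> \<bar>x k i \<omega>\<bar> \<le> C"
proof -
  have "i < n \<Longrightarrow> - C \<le> x k i \<omega> \<and> x k i \<omega> \<le> C"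
  proof (induction k arbitrary: i)
    case 0
    then have "\<bar>x0 i\<bar> \<le> C" unfolding C_def by (intro member_le_sum) auto
    then show ?case by (auto simp: abs_le_iff)
  qed (rule x_between)
  then show "i < n \<Longrightarrow> \<bar>x k i \<omega>\<bar> \<le> C" by (auto simp: abs_le_iff)
qed

lemma y_bounded: "\<bar>y k \<omega>\<bar> \<le> C"
proof -
  have "\<bar>y k \<omega>\<bar> \<le> (\<Sum>i<n. w i * C)"
    unfolding y_def
  proof (intro order_trans[OF sum_abs] sum_mono)
    fix i assume "i \<in> {..<n}"
    then have "0 < w i" "\<bar>x k i \<omega>\<bar> \<le> C" using w_pos x_bounded by auto
    then show "\<bar>w i * x k i \<omega>\<bar> \<le> w i * C" by (simp add: abs_mult)
  qed
  then show ?thesis by (simp add: sum_distrib_right[symmetric] w_sum)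
qed

lemma G_summable: "summable G"
  using G_nonneg G_sum[of _ 0] by (intro summableI_nonneg_bounded) auto

text \<open>The expected squared differences are dominated by the summable \<open>G\<close>. Hence
  the series of squared differences has finite expectation, is almost surely finite, and its terms
  tend to 0.\<close>

lemma AE_edge_diff:
  assumes ij: "i < n" "j < n" "a i j \<noteq> 0"
  shows "AE \<omega> in M. (\<lambda>k. x k j \<omega> - x k i \<omega>) \<longlonglongrightarrow> 0"
proof -
  let ?d = "\<lambda>k \<omega>. (x k j \<omega> - x k i \<omega>)^2"
  have int: "integrable M (?d k)" for k
    by (rule past_integrable[OF diff_det[OF ij(1,2)]])
  have sE: "summable (\<lambda>k. expectation (?d k))"
    by (rule summable_comparison_test'[OF G_summable, of 0]) (use G_edge[OF ij] in simp)
  have "(\<integral>\<^sup>+\<omega>. (\<Sum>k. ennreal (?d k \<omega>)) \<partial>M) = (\<Sum>k. \<integral>\<^sup>+\<omega>. ennreal (?d k \<omega>) \<partial>M)"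
    using int by (intro nn_integral_suminf) auto
  also have "\<dots> = (\<Sum>k. ennreal (expectation (?d k)))"
    using int by (simp add: nn_integral_eq_integral)
  also have "\<dots> = ennreal (\<Sum>k. expectation (?d k))"
    using sE by (intro suminf_ennreal2) auto
  finally have fin: "(\<integral>\<^sup>+\<omega>. (\<Sum>k. ennreal (?d k \<omega>)) \<partial>M) \<noteq> \<infinity>" by simp
  have "AE \<omega> in M. (\<Sum>k. ennreal (?d k \<omega>)) \<noteq> \<infinity>"
    using fin int by (intro nn_integral_PInf_AE) auto
  then show ?thesis
  proof eventually_elim
    case (elim \<omega>)
    then have "summable (\<lambda>k. ?d k \<omega>)"
      by (intro summable_suminf_not_top) auto
    then have "(\<lambda>k. sqrt (?d k \<omega>)) \<longlonglongrightarrow> sqrt 0"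
      by (intro tendsto_real_sqrt summable_LIMSEQ_zero)
    then show ?case by (simp add: tendsto_rabs_zero_iff)
  qed
qed

text \<open>A pathwise argument: connectedness spreads vanishing edge differences to all pairs, and
  the maximum of the values is nonincreasing and bounded, so it converges and carries all components
  with it.\<close>

lemma y_converges:
  assumes edge: "\<And>i j. i < n \<Longrightarrow> j < n \<Longrightarrow> a i j \<noteq> 0 \<Longrightarrow> (\<lambda>k. x k j \<omega> - x k i \<omega>) \<longlonglongrightarrow> 0"
  shows "(\<lambda>k. y k \<omega>) \<longlonglongrightarrow> xstar n a B x0 \<omega>"
proof -
  have diff: "(\<lambda>k. x k v \<omega> - x k u \<omega>) \<longlonglongrightarrow> 0" if "u < n" "v < n" for u v
  proof -
    have "(\<lambda>x y. x < n \<and> y < n \<and> a x y \<noteq> 0)\<^sup>*\<^sup>* u v"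
      using conn that by (auto simp: graph_connected_def)
    then show ?thesis
    proof (induction rule: rtranclp_induct)
      case (step z v)
      then show ?case using tendsto_add[OF step.IH edge[of z v]] by simp
    qed simp
  qed
  define mx where "mx k = Max ((\<lambda>i. x k i \<omega>) ` {..<n})" for k
  have le_mx: "x k i \<omega> \<le> mx k" if "i < n" for i k
    unfolding mx_def using that by (intro Max_ge) auto
  have mx_in: "\<exists>i<n. mx k = x k i \<omega>" for k
  proof -
    have "mx k \<in> (\<lambda>i. x k i \<omega>) ` {..<n}" unfolding mx_def using n2 by (intro Max_in) (auto simp: lessThan_empty_iff)
    then show ?thesis by auto
  qed
  have dec: "mx (Suc k) \<le> mx k" for k
  proof -
    obtain i where i: "i < n" "mx (Suc k) = x (Suc k) i \<omega>" using mx_in by blast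
    have "- C \<le> x (Suc k) i \<omega> \<and> x (Suc k) i \<omega> \<le> mx k"
      using le_mx x_bounded[of _ k \<omega>] i(1) by (intro x_between) (auto simp: abs_le_iff minus_le_iff)
    then show ?thesis using i by simp
  qed
  have "- C \<le> mx k" for k
    using mx_in[of k] x_bounded[of _ k \<omega>] by (auto simp: abs_le_iff minus_le_iff)
  moreover have "decseq mx" using dec by (simp add: decseq_Suc_iff)
  ultimately obtain L where L: "mx \<longlonglongrightarrow> L"
    using decseq_convergent[of mx "- C"] by blast
  have n0: "0 < n" using n2 by simp
  have "(\<lambda>k. mx k - x k 0 \<omega>) \<longlonglongrightarrow> 0"
  proof (rule Lim_null_comparison)
    show "\<forall>\<^sub>F k in sequentially. norm (mx k - x k 0 \<omega>) \<le> (\<Sum>i<n. \<bar>x k i \<omega> - x k 0 \<omega>\<bar>)"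
    proof (intro always_eventually allI)
      fix k
      obtain i where i: "i < n" "mx k = x k i \<omega>" using mx_in by blast
      then show "norm (mx k - x k 0 \<omega>) \<le> (\<Sum>i<n. \<bar>x k i \<omega> - x k 0 \<omega>\<bar>)"
        using member_le_sum[of i "{..<n}" "\<lambda>i. \<bar>x k i \<omega> - x k 0 \<omega>\<bar>"] by simp
    qed
    show "(\<lambda>k. \<Sum>i<n. \<bar>x k i \<omega> - x k 0 \<omega>\<bar>) \<longlonglongrightarrow> 0"
      using diff[OF n0] by (intro tendsto_null_sum tendsto_rabs_zero) auto
  qed
  from tendsto_diff[OF L this] have x0: "(\<lambda>k. x k 0 \<omega>) \<longlonglongrightarrow> L" by simp
  \<comment> \<open>\<open>xstar\<close> is defined by \<open>lim\<close>, so its value is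
    meaningful only once convergence of component 0 is known.\<close>
  then have L': "xstar n a B x0 \<omega> = L" by (simp add: xstar_def limI)
  have "(\<lambda>k. \<Sum>i<n. w i * (x k i \<omega> - x k 0 \<omega>)) \<longlonglongrightarrow> 0"
    using diff[OF n0] by (intro tendsto_null_sum tendsto_mult_right_zero) auto
  from tendsto_add[OF this x0] have "(\<lambda>k. (\<Sum>i<n. w i * (x k i \<omega> - x k 0 \<omega>)) + x k 0 \<omega>) \<longlonglongrightarrow> L" by simp
  \<comment> \<open>Because the weights sum to 1, \<open>y\<close> differs from component 0 by a
    weighted sum of vanishing differences.\<close>
  moreover have "(\<Sum>i<n. w i * (x k i \<omega> - x k 0 \<omega>)) + x k 0 \<omega> = y k \<omega>" for k
    by (simp add: right_diff_distrib sum_subtractf sum_distrib_right[symmetric] w_sum y_def)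
  ultimately show "(\<lambda>k. y k \<omega>) \<longlonglongrightarrow> xstar n a B x0 \<omega>" using L' by simp
qed

lemma AE_y_converges:
  "AE \<omega> in M. (\<lambda>k. y k \<omega>) \<longlonglongrightarrow> xstar n a B x0 \<omega>"
proof -
  have "AE \<omega> in M. \<forall>ij\<in>{ij\<in>{..<n}\<times>{..<n}. a (fst ij) (snd ij) \<noteq> 0}.
      (\<lambda>k. x k (snd ij) \<omega> - x k (fst ij) \<omega>) \<longlonglongrightarrow> 0"
    using AE_edge_diff by (intro AE_ball_countable[THEN iffD2]) (auto intro!: countable_finite)
  then show ?thesis
  proof eventually_elim
    case (elim \<omega>)
    show ?case by (rule y_converges) (use elim in auto)
  qed
qed

text \<open>The uniform bound \<open>C\<close> allows dominated convergence of the second moments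
  about \<open>c\<close>. The variance is at most the second moment about any point, so the mean of
  the limit need not be identified.\<close>

lemma xstar_variance:
  assumes bound: "\<And>T. expectation (\<lambda>\<omega>. (y T \<omega> - c)^2) \<le> b"
  shows "variance (xstar n a B x0) \<le> b"
proof -
  let ?X = "xstar n a B x0"
  have n0: "0 < n" using n2 by simp
  have xmeas: "x k 0 \<in> borel_measurable M" for k
    using past_integrable[OF x_det[OF n0]] by auto
  have meas: "?X \<in> borel_measurable M"
    unfolding xstar_def by (rule borel_measurable_lim_metric) (rule xmeas)
  have ymeas: "y k \<in> borel_measurable M" for k
    using past_integrable[OF y_det] by auto
  have bnd: "AE \<omega> in M. \<bar>?X \<omega>\<bar> \<le> C"
    using AE_y_converges
  proof eventually_elim
    case (elim \<omega>)
    then have "(\<lambda>k. \<bar>y k \<omega>\<bar>) \<longlonglongrightarrow> \<bar>?X \<omega>\<bar>" by (intro tendsto_rabs) auto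
    then show ?case by (rule LIMSEQ_le_const2) (use y_bounded in auto)
  qed
  have sq_bound: "(z - c)^2 \<le> (C + \<bar>c\<bar>)^2" if "\<bar>z\<bar> \<le> C" for z :: real
    using that by (subst abs_le_square_iff[symmetric]) auto
  have intX: "integrable M ?X"
    using bnd meas by (intro integrable_const_bound[of _ C]) auto
  have intX2: "integrable M (\<lambda>\<omega>. (?X \<omega> - c)^2)"
    using bnd meas by (intro integrable_const_bound[of _ "(C + \<bar>c\<bar>)^2"]) (auto elim!: eventually_mono intro!: sq_bound)
  have "(\<lambda>k. expectation (\<lambda>\<omega>. (y k \<omega> - c)^2)) \<longlonglongrightarrow> expectation (\<lambda>\<omega>. (?X \<omega> - c)^2)"
  proof (rule integral_dominated_convergence[where w = "\<lambda>_. (C + \<bar>c\<bar>)^2"])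
    show "AE \<omega> in M. (\<lambda>k. (y k \<omega> - c)^2) \<longlonglongrightarrow> (?X \<omega> - c)^2"
      using AE_y_converges by eventually_elim (auto intro!: tendsto_intros)
    show "AE \<omega> in M. norm ((y k \<omega> - c)^2) \<le> (C + \<bar>c\<bar>)^2" for k
      using sq_bound[OF y_bounded] by simp
  qed (use meas ymeas in auto)
  then have lim: "expectation (\<lambda>\<omega>. (?X \<omega> - c)^2) \<le> b"
    by (rule LIMSEQ_le_const2) (use bound in auto)
  let ?m = "expectation ?X"
  have "variance ?X = expectation (\<lambda>\<omega>. (?X \<omega> - c)^2 - 2 * (?m - c) * ?X \<omega> + (?m^2 - c^2))"
    by (intro Bochner_Integration.integral_cong refl) (simp add: power2_eq_square algebra_simps)
  also have "\<dots> = expectation (\<lambda>\<omega>. (?X \<omega> - c)^2) - 2 * (?m - c) * ?m + (?m^2 - c^2)"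
    using intX intX2 by (simp add: prob_space)
  also have "\<dots> = expectation (\<lambda>\<omega>. (?X \<omega> - c)^2) - (?m - c)^2"
    by (simp add: power2_eq_square algebra_simps)
  also have "\<dots> \<le> expectation (\<lambda>\<omega>. (?X \<omega> - c)^2)" by simp
  finally show ?thesis using lim by simp
qed

section \<open>The eigenvalue product of the expected matrix and the final estimate\<close>

lemma eigenvalue_product:
  assumes len: "length ls = n"
    and cp: "char_poly (EW n a p) = (\<Prod>l\<leftarrow>ls. [:- l, 1:])"
    and ord: "\<forall>i j. i \<le> j \<and> j < n \<longrightarrow> \<bar>1 - ls ! i\<bar> \<le> \<bar>1 - ls ! j\<bar>"
    and k: "k < n"
  defines "R \<equiv> \<Prod>ij\<in>({..<n} \<times> {..<n}) - {(0,0)}. (1 - ls ! fst ij * ls ! snd ij)"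
  shows "0 < R" and "R * (1 - w k) \<le> 4 * (1 - M1 n a p k)"
proof -
  have Pii: "P i i = M1 n a p i" if "i < n" for i using that by (simp add: P_def a_diag)
  have P_nonneg: "0 \<le> P i j" if "i < n" "j < n" for i j
    using M1_bounds[OF that(1)] n2 degpos[OF that(1)] a01[OF that(2,1)] that
    by (auto simp: P_def a_diag intro: order_trans[of 0 "1 / real n"])
  have P_diag: "0 < P i i" if "i < n" for i
    using M1_bounds(1)[OF that] n2 Pii[OF that] by (auto intro: less_le_trans[of 0 "1 / real n"])
  have irr: "(\<lambda>x y. x < n \<and> y < n \<and> P x y \<noteq> 0)\<^sup>*\<^sup>* u v" if "u < n" "v < n" for u v
  proof -
    have "(\<lambda>x y. x < n \<and> y < n \<and> a x y \<noteq> 0)\<^sup>*\<^sup>* u v"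
      using conn that by (auto simp: graph_connected_def)
    moreover have "P x y \<noteq> 0" if "x < n" "y < n" "a x y \<noteq> 0" for x y
      using w_P[of x y] that a_diag Z_pos by fastforce
    ultimately show ?thesis by (elim rtranclp_mono[THEN predicate2D, rotated]) auto
  qed
  \<comment> \<open>Each of the \<open>n\<close> diagonal entries of \<open>P\<close> is a mean
    \<open>M1\<close>, and each is at least \<open>1/n\<close>.\<close>
  have tr: "1 \<le> (\<Sum>i<n. P i i)"
  proof -
    have "(\<Sum>i<n. 1 / real n) \<le> (\<Sum>i<n. P i i)"
      using M1_bounds(1) Pii by (intro sum_mono) auto
    then show ?thesis using n2 by simp
  qed
  have EW: "EW n a p = mat n n (\<lambda>(i,j). P i j)" by (simp add: EW_def P_def)
  note * = reversible_eigenvalue_product[OF n2 w_pos w_sum w_rev P_nonneg P_diag P_row_sum irr tr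
      cp[unfolded EW] len _ k, folded R_def]
  show "0 < R" using *(1) ord by blast
  show "R * (1 - w k) \<le> 4 * (1 - M1 n a p k)" using *(2) ord Pii[OF k] by auto
qed

lemma variance_bound:
  assumes len: "length ls = n"
    and cp: "char_poly (EW n a p) = (\<Prod>l\<leftarrow>ls. [:- l, 1:])"
    and ord: "\<forall>i j. i \<le> j \<and> j < n \<longrightarrow> \<bar>1 - ls ! i\<bar> \<le> \<bar>1 - ls ! j\<bar>"
  shows "variance (xstar n a B x0)
     \<le> (\<Sum>i<n. \<Sum>j<n. \<bar>x0 i * x0 j\<bar>) * (MAX i\<in>{..<n}. Sfac n a p i)
       * (2 * (real n ^ 2 - 1)
          / (\<Prod>ij\<in>({..<n} \<times> {..<n}) - {(0,0)}. (1 - ls ! fst ij * ls ! snd ij)))"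
proof -
  define Sm where "Sm = (MAX i\<in>{..<n}. Sfac n a p i)"
  define N where "N = (\<Sum>i<n. \<Sum>j<n. \<bar>x0 i * x0 j\<bar>)"
  define R where "R = (\<Prod>ij\<in>({..<n} \<times> {..<n}) - {(0,0)}. (1 - ls ! fst ij * ls ! snd ij))"
  have n0: "0 < n" using n2 by simp
  have Sm: "Sfac n a p i \<le> Sm" if "i < n" for i
    unfolding Sm_def using that by (intro Max_ge) auto
  have Sm0: "0 \<le> Sm" using Sm[OF n0] Sfac_nonneg[OF n0] by simp
  have N0: "0 \<le> N" unfolding N_def by (intro sum_nonneg) auto
  \<comment> \<open>A vertex of maximal weight plays two roles: \<open>w k\<close> bounds all
    weights in the variance growth, and \<open>x0 k\<close> is the centre of the energy. This yields
    the product \<open>w k * Z\<close> and the factor \<open>1 - w k\<close>.\<close>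
  have "Max (w ` {..<n}) \<in> w ` {..<n}" using n0 by (intro Max_in) auto
  then obtain k where k: "k < n" "w k = Max (w ` {..<n})" by auto
  have wk: "w i \<le> w k" if "i < n" for i unfolding k(2) using that by (intro Max_ge) auto
  have wk1: "w k \<le> 1" using member_le_sum[of k "{..<n}" w] w_pos w_sum k(1) by (auto simp: less_imp_le)
  have R: "0 < R" "R * (1 - w k) \<le> 4 * (1 - M1 n a p k)"
    using eigenvalue_product[OF len cp ord k(1), folded R_def] by auto
  define d where "d = deg n a k"
  define r where "r = 1 - M1 n a p k"
  have r: "0 < r" using M1_bounds(2)[OF k(1)] by (simp add: r_def)
  have d: "0 \<le> d" "d \<le> real n - 1"
    using deg_nbrs[OF k(1)] card_nbrs[OF k(1)] n2 by (auto simp: d_def)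
  have wZ: "w k * Z = d / r" using Z_pos by (simp add: w_def d_def r_def)
  have "variance (xstar n a B x0) \<le> (w k)^2 * (Sm / 2) * (real n * Z * ((1 - w k) * N))"
  proof (rule xstar_variance)
    fix T
    have "(\<Sum>k<T. G k) \<le> real n * Z * Q (x0 k) 0" by (rule G_sum)
    also have "\<dots> \<le> real n * Z * ((1 - w k) * N)"
      using Q_0_le[OF k(1), folded N_def] Z_pos by (intro mult_left_mono) auto
    finally have G: "(\<Sum>k<T. G k) \<le> real n * Z * ((1 - w k) * N)" .
    have "expectation (\<lambda>\<omega>. (y T \<omega> - (\<Sum>i<n. w i * x0 i))^2) \<le> (w k)^2 * (Sm / 2) * (\<Sum>k<T. G k)"
      by (rule y_variance[OF wk Sm])
    also have "\<dots> \<le> (w k)^2 * (Sm / 2) * (real n * Z * ((1 - w k) * N))"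
      using Sm0 by (intro mult_left_mono[OF G]) auto
    finally show "expectation (\<lambda>\<omega>. (y T \<omega> - (\<Sum>i<n. w i * x0 i))^2) \<le> (w k)^2 * (Sm / 2) * (real n * Z * ((1 - w k) * N))" .
  qed
  also have "\<dots> = w k * (Sm / 2 * N * real n * (w k * Z) * (1 - w k))"
    by (simp add: power2_eq_square)
  \<comment> \<open>One of the two factors \<open>w k\<close> is estimated by 1; the other has been
    paired with \<open>Z\<close> to give \<open>d / r\<close>.\<close>
  also have "\<dots> \<le> 1 * (Sm / 2 * N * real n * (w k * Z) * (1 - w k))"
    using wk1 Sm0 N0 w_pos[OF k(1)] Z_pos by (intro mult_right_mono mult_nonneg_nonneg) auto
  also have "\<dots> = Sm / 2 * N * real n * d * ((1 - w k) / r)"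
    by (simp add: wZ)
  \<comment> \<open>The spectral estimate replaces \<open>(1 - w k) / r\<close> by
    \<open>4 / R\<close>; together with the factor 1/2 from the variance this produces the constant
    2.\<close>
  also have "\<dots> \<le> Sm / 2 * N * real n * d * (4 / R)"
    using R r Sm0 N0 d(1)
    by (intro mult_left_mono mult_nonneg_nonneg) (auto simp: r_def field_simps)
  also have "\<dots> = 2 * (Sm * N * (real n * d)) / R" by simp
  also have "\<dots> \<le> 2 * (Sm * N * (real n ^ 2 - 1)) / R"
  proof -
    \<comment> \<open>The degree is at most \<open>n - 1\<close>, and relaxing \<open>n\<close> to
      \<open>n + 1\<close> gives the stated form \<open>n^2 - 1\<close>.\<close>
    have "real n * d \<le> (real n + 1) * (real n - 1)" using d n2 by (intro mult_mono) auto
    then have "real n * d \<le> real n ^ 2 - 1" by (simp add: power2_eq_square algebra_simps)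
    then show ?thesis using Sm0 N0 R(1) by (intro divide_right_mono mult_left_mono mult_nonneg_nonneg) auto
  qed
  also have "\<dots> = N * Sm * (2 * (real n ^ 2 - 1) / R)"
  proof -
    have "2 * (s * m * z) / r = m * s * (2 * z / r)" for s m z r :: real by simp
    then show ?thesis .
  qed
  finally show ?thesis unfolding Sm_def N_def R_def .
qed

end

theorem theorem2:
  fixes n :: nat and a :: "nat \<Rightarrow> nat \<Rightarrow> real" and p :: "nat \<Rightarrow> real"
    and M :: "'w measure" and B :: "nat \<Rightarrow> nat \<Rightarrow> nat \<Rightarrow> 'w \<Rightarrow> bool"
    and x0 :: "nat \<Rightarrow> real" and ls :: "real list"
  assumes n2: "n \<ge> 2"
    and graph: "adj_graph n a"
    and conn: "graph_connected n a"
    and degpos: "\<forall>v<n. deg n a v \<ge> 1"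
    and p01: "\<forall>v<n. 0 < p v \<and> p v < 1"
    and probM: "prob_space M"
    and Bmeas: "\<And>k u v. B k u v \<in> measurable M (count_space UNIV)"
    and Bindep: "prob_space.indep_vars M (\<lambda>_. count_space UNIV) (\<lambda>(k,u,v). B k u v)
                   (UNIV \<times> {..<n} \<times> {..<n})"
    and Bprob: "\<And>k u v. u < n \<Longrightarrow> v < n \<Longrightarrow>
                   measure M {\<omega> \<in> space M. B k u v \<omega>} = p v"
    and eig_len: "length ls = n"
    and eig: "char_poly (EW n a p) = (\<Prod>l\<leftarrow>ls. [:- l, 1:])"
    and eig_ord: "\<forall>i j. i \<le> j \<and> j < n \<longrightarrow> \<bar>1 - ls ! i\<bar> \<le> \<bar>1 - ls ! j\<bar>"
  shows "prob_space.variance M (xstar n a B x0)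
     \<le> (\<Sum>i<n. \<Sum>j<n. \<bar>x0 i * x0 j\<bar>) * (MAX i\<in>{..<n}. Sfac n a p i)
       * (2 * (real n ^ 2 - 1)
          / (\<Prod>ij\<in>({..<n} \<times> {..<n}) - {(0,0)}. (1 - ls ! fst ij * ls ! snd ij)))"
proof -
  interpret prob_space M by (rule probM)
  interpret gossip M n a p B x0
    by unfold_locales
      ((rule n2 graph conn Bindep) | (rule Bprob degpos[rule_format] p01[rule_format], assumption+))+
  show ?thesis by (rule variance_bound[OF eig_len eig eig_ord])
qed

end
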